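(* Let $n$ be a positive integer with $\omega(n)\ge 2$. Then $\tilde{\Gamma}_{\mathcal{H}}(\mathbb{Z}_n)$ is planar if and only if $n$ is equal to $p_1^{\alpha_1}p_2$ or $p_1^{\alpha_1}p_2^2$ or $p_1p_2p_3$ or $p_1^2p_2p_3$, for some distinct primes $p_1,p_2,p_3$ and some positive integer $\alpha_1$.
   Context: $\omega(n)$ denotes the number of distinct prime divisors of $n$. A hypergraph is a pair $(V,E)$ with $E$ a set of subsets of $V$ (hyperedges). For a group $G$ with identity $e$, let $S$ be the set of all non-trivial proper subgroups of $G$. The intersection hypergraph $\tilde{\Gamma}_{\mathcal{H}}(G)$ has vertex set $V=\{H\in S : H\cap K=\{e\}\text{ for some }K\in S\}$, and $E\subseteq V$ is a hyperedge if and only if (1) for distinct $H,K\in E$, $H\cap K=\{e\}$; and (2) there is no $E'\subseteq V$ with $E'\supsetneq E$ satisfying (1). The incidence graph $\mathcal{I}(\mathcal{H})$ of a hypergraph $\mathcal{H}$ is the bipartite graph with vertex set $V(\mathcal{H})\cup E(\mathcal{H})$ (disjoint union) in which $v\in V(\mathcal{H})$ is adjacent to $e\in E(\mathcal{H})$ if and only if $v\in e$. A hypergraph is planar if and only if its incidence graph is a planar graph. *)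

theory Defs
  imports
    "HOL-Algebra.Elementary_Groups"
    "HOL-Computational_Algebra.Primes"
    "HOL-Analysis.Analysis"
begin

text \<open>A hypergraph is a pair of a vertex set and a set of hyperedges; a simple graph is the
  special case in which every edge has exactly two elements.\<close>

type_synonym 'v hypergraph = "'v set \<times> 'v set set"

abbreviation hverts :: "'v hypergraph \<Rightarrow> 'v set"
  where "hverts \<equiv> fst"

abbreviation hedges :: "'v hypergraph \<Rightarrow> 'v set set"
  where "hedges \<equiv> snd"

definition nontrivial_proper_subgroups :: "('a, 'b) monoid_scheme \<Rightarrow> 'a set set"
  where "nontrivial_proper_subgroups G =
    {H. subgroup H G \<and> H \<noteq> {\<one>\<^bsub>G\<^esub>} \<and> H \<noteq> carrier G}"

definition ih_verts :: "('a, 'b) monoid_scheme \<Rightarrow> 'a set set"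
  where "ih_verts G =
    {H \<in> nontrivial_proper_subgroups G.
      \<exists>K \<in> nontrivial_proper_subgroups G. H \<inter> K = {\<one>\<^bsub>G\<^esub>}}"

definition pairwise_trivial :: "('a, 'b) monoid_scheme \<Rightarrow> 'a set set \<Rightarrow> bool"
  where "pairwise_trivial G E \<longleftrightarrow> pairwise (\<lambda>H K. H \<inter> K = {\<one>\<^bsub>G\<^esub>}) E"

definition intersection_hypergraph :: "('a, 'b) monoid_scheme \<Rightarrow> 'a set hypergraph"
  where "intersection_hypergraph G =
    (ih_verts G,
     {E. E \<subseteq> ih_verts G \<and> pairwise_trivial G E \<and>
         \<not> (\<exists>E'. E' \<subseteq> ih_verts G \<and> E \<subset> E' \<and> pairwise_trivial G E')})"

definition incidence_graph :: "'v hypergraph \<Rightarrow> ('v + 'v set) hypergraph"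
  where "incidence_graph X =
    (hverts X <+> hedges X,
     {{Inl v, Inr e} | v e. v \<in> hverts X \<and> e \<in> hedges X \<and> v \<in> e})"

text \<open>A drawing of a simple graph in the plane (the complex numbers): distinct vertices go to
  distinct points, an edge \<open>{u, v}\<close> goes to a simple arc joining the points of \<open>u\<close> and \<open>v\<close> and
  passing through no other vertex, and two different arcs meet at most in the points of their
  common endvertices. The direction in which an arc is parametrised is left open.\<close>

definition plane_drawing ::
    "'v hypergraph \<Rightarrow> ('v \<Rightarrow> complex) \<Rightarrow> ('v set \<Rightarrow> real \<Rightarrow> complex) \<Rightarrow> bool"
  where "plane_drawing X pos crv \<longleftrightarrow>
    inj_on pos (hverts X) \<and>
    (\<forall>e \<in> hedges X. arc (crv e) \<and>
       {pathstart (crv e), pathfinish (crv e)} = pos ` e \<and>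
       path_image (crv e) \<inter> pos ` hverts X = pos ` e) \<and>
    (\<forall>e \<in> hedges X. \<forall>f \<in> hedges X. e \<noteq> f \<longrightarrow>
       path_image (crv e) \<inter> path_image (crv f) \<subseteq> pos ` (e \<inter> f))"

definition planar_graph :: "'v hypergraph \<Rightarrow> bool"
  where "planar_graph X \<longleftrightarrow> (\<exists>pos crv. plane_drawing X pos crv)"

definition planar_hypergraph :: "'v hypergraph \<Rightarrow> bool"
  where "planar_hypergraph X \<longleftrightarrow> planar_graph (incidence_graph X)"

end

theory Submission
  imports Defs "HOL-Algebra.Multiplicative_Group"
begin

text \<open>The subgroups of the cyclic group of order \<open>n\<close> correspond to the divisors of \<open>n\<close>, with
  trivial intersections corresponding to disjoint sets of prime factors. So the vertices are the
  divisors \<open>d \<noteq> 1\<close> missing some prime factor of \<open>n\<close>, and the hyperedges are the sets of vertices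
  whose sets of prime factors partition the set of prime factors of \<open>n\<close>.

  In all cases not listed in the theorem the incidence graph contains a subdivision of
  \<open>K\<^sub>3\<^sub>,\<^sub>3\<close>, of one of four shapes: two primes with exponents at least 3; three primes or more, one of
  them with exponent at least 3; three primes or more, two of them with exponent at least 2; four
  primes or more. That these do not embed in the plane follows from the Jordan curve theorem: a theta
  curve, made of three arcs joining two branch vertices, has no face with inner points of all three
  arcs on its boundary. In the listed cases a straight-line drawing is written down.\<close>

section \<open>Theta curves in the plane\<close>

text \<open>Deleting one vertex \<open>b\<close> from K(3,3) leaves K(2,3), whose drawings are
  exactly theta curves; so all the topology sits in the impossibility of joining one point
  \<open>b\<close> to inner points of the three arcs. Why the list looks as it does: with two primes
  of exponents \<open>a\<close> and \<open>b\<close> the incidence graph is K(a,b) with every edge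
  subdivided once, so one exponent may be unbounded provided that the other is at most 2. With a
  third prime this freedom is lost: each power of \<open>p\<close> gives a hyperedge joined to
  \<open>q\<close>, to \<open>r\<close> and, by way of that power, to \<open>q r\<close>, and three
  such hyperedges are too many. Hyperedges are partitions because of maximality: a prime not yet
  used is itself a vertex (here at least two primes are needed) and could be added, while anything
  added to a partition reuses a prime. Only the set of primes of a divisor matters. Surplus primes
  can therefore be merged into one block, which reduces any number of primes to two, three or four
  blocks, and higher exponents merely supply several vertices with the same block.\<close>

definition arc_between :: "complex set \<Rightarrow> complex \<Rightarrow> complex \<Rightarrow> bool"
  where "arc_between S u v \<longleftrightarrow>
    (\<exists>c. arc c \<and> path_image c = S \<and> pathstart c = u \<and> pathfinish c = v)"

lemma arc_betweenD:
  assumes "arc_between S u v"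
  shows "u \<in> S" "v \<in> S" "u \<noteq> v" "compact S" "connected S"
  using assms
  by (auto simp: arc_between_def arc_imp_path compact_path_image connected_path_image dest: arc_distinct_ends)

lemma arc_between_commute:
  assumes "arc_between S u v"
  shows "arc_between S v u"
  using assms unfolding arc_between_def
  by (metis arc_reversepath path_image_reversepath pathfinish_reversepath pathstart_reversepath)

lemma arc_between_join:
  assumes "arc_between S u v" "arc_between T v w" "S \<inter> T \<subseteq> {v}"
  shows "arc_between (S \<union> T) u w"
proof -
  obtain c d where "arc c" "path_image c = S" "pathstart c = u" "pathfinish c = v"
    and "arc d" "path_image d = T" "pathstart d = v" "pathfinish d = w"
    using assms unfolding arc_between_def by blast
  with assms(3) show ?thesis unfolding arc_between_def
    by (intro exI[of _ "c +++ d"]) (auto simp: path_image_join intro!: arc_join)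
qed

text \<open>Running along one arc and back along the other gives a simple closed path, to which the
  Jordan curve theorem applies.\<close>

lemma Jordan_two_arcs:
  assumes "arc_between S u v" "arc_between T u v" "S \<inter> T = {u, v}"
  shows "connected (inside (S \<union> T))" "connected (outside (S \<union> T))" "bounded (inside (S \<union> T))"
    "inside (S \<union> T) \<noteq> {}" "open (inside (S \<union> T))"
    "inside (S \<union> T) \<inter> outside (S \<union> T) = {}" "inside (S \<union> T) \<union> outside (S \<union> T) = - (S \<union> T)"
    "frontier (inside (S \<union> T)) = S \<union> T"
proof -
  obtain c d where c: "arc c" "path_image c = S" "pathstart c = u" "pathfinish c = v"
    and d: "arc d" "path_image d = T" "pathstart d = u" "pathfinish d = v"
    using assms unfolding arc_between_def by blast
  have "simple_path (c +++ reversepath d)" "pathfinish (c +++ reversepath d) = pathstart (c +++ reversepath d)"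
    "path_image (c +++ reversepath d) = S \<union> T"
    using c d assms(3)
    by (auto simp: path_image_join arc_reversepath intro!: simple_path_join_loop)
  with Jordan_inside_outside[of "c +++ reversepath d"]
  show "connected (inside (S \<union> T))" "connected (outside (S \<union> T))" "bounded (inside (S \<union> T))"
    "inside (S \<union> T) \<noteq> {}" "open (inside (S \<union> T))"
    "inside (S \<union> T) \<inter> outside (S \<union> T) = {}" "inside (S \<union> T) \<union> outside (S \<union> T) = - (S \<union> T)"
    "frontier (inside (S \<union> T)) = S \<union> T"
    by auto
qed

text \<open>Inside and outside are both open, so a connected set that misses the curve cannot meet
  both of them.\<close>

lemma not_connected_inside_outside:
  assumes "arc_between S u v" "arc_between T u v" "S \<inter> T = {u, v}"
    and "connected D" "D \<inter> (S \<union> T) = {}" "x \<in> D" "y \<in> D" "x \<in> inside (S \<union> T)"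
  shows "y \<in> inside (S \<union> T)"
proof -
  let ?C = "S \<union> T"
  note J = Jordan_two_arcs[OF assms(1-3)]
  have "compact ?C" using assms(1,2) by (meson arc_betweenD(4) compact_Un)
  then have "open (outside ?C)" by (simp add: compact_imp_closed open_outside)
  with J(5,6,7) connectedD[OF assms(4), of "inside ?C" "outside ?C"] assms(5-8)
  show ?thesis by blast
qed

text \<open>If no arc runs inside the closed curve formed by the other two, then a disc bounded by two of
  the arcs is disjoint from the discs bounded by the third arc and
  either of these two, so a point of it would be joined to a far point in the complement of both
  of the other closed curves; by Janiszewski's theorem also in the complement of their union.\<close>

lemma theta_arc_inside:
  assumes arcs: "arc_between S1 u v" "arc_between S2 u v" "arc_between S3 u v"
    and ints: "S1 \<inter> S2 = {u, v}" "S1 \<inter> S3 = {u, v}" "S2 \<inter> S3 = {u, v}"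
    and ne: "\<not> S1 \<subseteq> {u, v}" "\<not> S2 \<subseteq> {u, v}"
    and out: "S3 \<inter> inside (S1 \<union> S2) = {}" "S1 \<inter> inside (S3 \<union> S2) = {}"
      "S2 \<inter> inside (S3 \<union> S1) = {}"
  shows False
proof -
  have ints': "S3 \<inter> S2 = {u, v}" "S3 \<inter> S1 = {u, v}" using ints by auto
  note J12 = Jordan_two_arcs[OF arcs(1,2) ints(1)]
  note J32 = Jordan_two_arcs[OF arcs(3,2) ints'(1)]
  note J31 = Jordan_two_arcs[OF arcs(3,1) ints'(2)]
  let ?I = "inside (S1 \<union> S2)"
  have disj: "?I \<inter> (S1 \<union> S2 \<union> S3) = {}" using J12(7) out(1) by blast
  \<comment> \<open>If the disc \<open>?I\<close> met the disc bounded by \<open>S3\<close> and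
    \<open>T\<close>, connectedness would put it inside that disc, and its frontier, which contains
    \<open>T'\<close>, into the closed disc. But \<open>T'\<close> avoids the open disc and meets
    the boundary curve only in \<open>u\<close> and \<open>v\<close>.\<close>
  have *: "?I \<subseteq> outside (S3 \<union> T)"
    if T: "T = S1 \<or> T = S2" and T': "T' = S1 \<or> T' = S2" "S3 \<inter> T' = {u,v}" "T' \<inter> T = {u,v}"
      and "\<not> T' \<subseteq> {u, v}" "T' \<inter> inside (S3 \<union> T) = {}"
      "arc_between T u v" "S3 \<inter> T = {u, v}" for T T'
  proof (rule ccontr)
    note J = Jordan_two_arcs[OF arcs(3) that(7,8)]
    assume "\<not> ?I \<subseteq> outside (S3 \<union> T)"
    then obtain x where x: "x \<in> ?I" "x \<in> inside (S3 \<union> T)" using J(7) disj T by blast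
    have "?I \<subseteq> inside (S3 \<union> T)"
    proof
      fix y assume "y \<in> ?I"
      with x show "y \<in> inside (S3 \<union> T)"
        using not_connected_inside_outside[OF arcs(3) that(7,8) J12(1), of x y] disj T by blast
    qed
    then have "closure ?I \<subseteq> closure (inside (S3 \<union> T))" by (rule closure_mono)
    then have "frontier ?I \<subseteq> inside (S3 \<union> T) \<union> (S3 \<union> T)"
      using J(8) closure_Un_frontier[of "inside (S3 \<union> T)"] closure_Un_frontier[of ?I] by blast
    then have "T' \<subseteq> inside (S3 \<union> T) \<union> (S3 \<union> T)" using J12(8) T'(1) by blast
    then show False using that by blast
  qed
  have o32: "?I \<subseteq> outside (S3 \<union> S2)"
    by (rule *[where T' = S1]) (use arcs ints ints' ne out in auto)
  have o31: "?I \<subseteq> outside (S3 \<union> S1)"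
    by (rule *[where T' = S2]) (use arcs ints ints' ne out in auto)
  obtain x where x: "x \<in> ?I" using J12(4) by blast
  have "bounded (S1 \<union> S2 \<union> S3)" "bounded ?I" "bounded (inside (S3 \<union> S2))" "bounded (inside (S3 \<union> S1))"
    using arcs J12(3) J32(3) J31(3) by (auto intro: arc_betweenD(4) compact_imp_bounded)
  then have "bounded (S1 \<union> S2 \<union> S3 \<union> ?I \<union> inside (S3 \<union> S2) \<union> inside (S3 \<union> S1))"
    by (simp add: bounded_Un)
  then obtain y where y: "y \<notin> S1 \<union> S2 \<union> S3 \<union> ?I \<union> inside (S3 \<union> S2) \<union> inside (S3 \<union> S1)"
    by (metis UNIV_eq_I not_bounded_UNIV)
  have y2: "y \<in> outside (S3 \<union> S2)" "y \<in> outside (S3 \<union> S1)" using y J32(7) J31(7) by blast+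
  have os: "outside (S3 \<union> S2) \<subseteq> - (S3 \<union> S2)" "outside (S3 \<union> S1) \<subseteq> - (S3 \<union> S1)"
    using J32(7) J31(7) by blast+
  have "connected_component (- ((S3 \<union> S2) \<union> (S3 \<union> S1))) x y"
  proof (rule Janiszewski)
    show "compact (S3 \<union> S2)" "closed (S3 \<union> S1)"
      using arcs[THEN arc_betweenD(4)] by (auto intro: compact_imp_closed)
    \<comment> \<open>Janiszewski's theorem wants a connected intersection: the two closed curves
      have exactly the arc \<open>S3\<close> in common.\<close>
    have "(S3 \<union> S2) \<inter> (S3 \<union> S1) = S3" using ints ints' by blast
    then show "connected ((S3 \<union> S2) \<inter> (S3 \<union> S1))" using arcs(3) arc_betweenD(5) by auto
    show "connected_component (- (S3 \<union> S2)) x y"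
      unfolding connected_component_def
      by (intro exI[of _ "outside (S3 \<union> S2)"]) (use J32(2) x o32 y2 os in blast)
    show "connected_component (- (S3 \<union> S1)) x y"
      unfolding connected_component_def
      by (intro exI[of _ "outside (S3 \<union> S1)"]) (use J31(2) x o31 y2 os in blast)
  qed
  then obtain D where "connected D" "D \<subseteq> - ((S3 \<union> S2) \<union> (S3 \<union> S1))" "x \<in> D" "y \<in> D"
    unfolding connected_component_def by blast
  then have "y \<in> ?I"
    by (intro not_connected_inside_outside[OF arcs(1,2) ints(1), of D x y]) (use x in auto)
  with y show False by blast
qed

text \<open>Here \<open>S3\<close> cuts the disc bounded by \<open>S1\<close> and \<open>S2\<close>
  into two discs. The set \<open>D3\<close> leads from \<open>a3\<close> to \<open>b\<close> without
  crossing the outer curve, so \<open>b\<close> lies in one of the two halves. The boundary of a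
  half misses the inner points of \<open>S1\<close> or those of \<open>S2\<close>, although
  \<open>D1\<close> or \<open>D2\<close> leads from \<open>b\<close> to such a point.\<close>

lemma theta_face_aux:
  assumes arcs: "arc_between S1 u v" "arc_between S2 u v" "arc_between S3 u v"
    and ints: "S1 \<inter> S2 = {u, v}" "S1 \<inter> S3 = {u, v}" "S2 \<inter> S3 = {u, v}"
    and a: "a1 \<in> S1 - {u, v}" "a2 \<in> S2 - {u, v}" "a3 \<in> S3 - {u, v}"
    and D: "connected D1" "connected D2" "connected D3"
      "b \<in> D1" "b \<in> D2" "b \<in> D3" "a1 \<in> D1" "a2 \<in> D2" "a3 \<in> D3"
    and int: "D1 \<inter> (S1 \<union> S2 \<union> S3) = {a1}" "D2 \<inter> (S1 \<union> S2 \<union> S3) = {a2}"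
      "D3 \<inter> (S1 \<union> S2 \<union> S3) = {a3}"
    and b: "b \<notin> S1 \<union> S2 \<union> S3"
    and ins: "S3 \<inter> inside (S1 \<union> S2) \<noteq> {}"
  shows False
proof -
  obtain c1 where c1: "arc c1" "path_image c1 = S1" "pathstart c1 = u" "pathfinish c1 = v"
    using arcs(1) unfolding arc_between_def by blast
  obtain c2 where c2: "arc c2" "path_image c2 = S2" "pathstart c2 = u" "pathfinish c2 = v"
    using arcs(2) unfolding arc_between_def by blast
  obtain c3 where c3: "arc c3" "path_image c3 = S3" "pathstart c3 = u" "pathfinish c3 = v"
    using arcs(3) unfolding arc_between_def by blast
  have split: "inside (S1 \<union> S3) \<union> inside (S2 \<union> S3) \<union> (S3 - {u, v}) = inside (S1 \<union> S2)"
    using split_inside_simple_closed_curve[of c1 u v c2 c3] c1 c2 c3 ints ins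
      arc_betweenD(3)[OF arcs(1)]
    by (metis arc_imp_simple_path)
  note J12 = Jordan_two_arcs[OF arcs(1,2) ints(1)]
  have "a3 \<in> inside (S1 \<union> S2)" using split a by blast
  moreover have "a3 \<notin> S1 \<union> S2" using a ints by blast
  ultimately have "b \<in> inside (S1 \<union> S2)"
    by (intro not_connected_inside_outside[OF arcs(1,2) ints(1), of D3 a3 b]) (use D int in auto)
  with split b consider "b \<in> inside (S1 \<union> S3)" | "b \<in> inside (S2 \<union> S3)" by blast
  then show False
  proof cases
    case 1
    have "a2 \<notin> S1 \<union> S3" using a ints by blast
    then have "a2 \<in> inside (S1 \<union> S3)" using 1
      by (intro not_connected_inside_outside[OF arcs(1,3) ints(2), of D2 b a2]) (use D int in auto)
    with split J12(7) a show False by blast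
  next
    case 2
    have "a1 \<notin> S2 \<union> S3" using a ints by blast
    then have "a1 \<in> inside (S2 \<union> S3)" using 2
      by (intro not_connected_inside_outside[OF arcs(2,3) ints(3), of D1 b a1]) (use D int in auto)
    with split J12(7) a show False by blast
  qed
qed

text \<open>The topological content of the non-planarity of \<open>K\<^sub>3\<^sub>,\<^sub>3\<close>.\<close>

lemma theta_face:
  assumes arcs: "arc_between S1 u v" "arc_between S2 u v" "arc_between S3 u v"
    and ints: "S1 \<inter> S2 = {u, v}" "S1 \<inter> S3 = {u, v}" "S2 \<inter> S3 = {u, v}"
    and a: "a1 \<in> S1 - {u, v}" "a2 \<in> S2 - {u, v}" "a3 \<in> S3 - {u, v}"
    and D: "connected D1" "connected D2" "connected D3"
      "b \<in> D1" "b \<in> D2" "b \<in> D3" "a1 \<in> D1" "a2 \<in> D2" "a3 \<in> D3"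
    and int: "D1 \<inter> (S1 \<union> S2 \<union> S3) = {a1}" "D2 \<inter> (S1 \<union> S2 \<union> S3) = {a2}"
      "D3 \<inter> (S1 \<union> S2 \<union> S3) = {a3}"
    and b: "b \<notin> S1 \<union> S2 \<union> S3"
  shows False
proof -
  have "\<not> S1 \<subseteq> {u, v}" "\<not> S2 \<subseteq> {u, v}" using a by auto
  from theta_arc_inside[OF arcs ints this]
  consider "S3 \<inter> inside (S1 \<union> S2) \<noteq> {}" | "S1 \<inter> inside (S3 \<union> S2) \<noteq> {}"
    | "S2 \<inter> inside (S3 \<union> S1) \<noteq> {}" by blast
  \<comment> \<open>The situation is symmetric in the three arcs; whichever runs inside is moved to
    the third place.\<close>
  then show False
  proof cases
    case 1
    show False by (rule theta_face_aux[OF arcs ints a D int b 1])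
  next
    case 2
    show False
      by (rule theta_face_aux[OF arcs(3,2,1) _ _ _ a(3,2,1) D(3,2,1) D(6,5,4) D(9,8,7) _ _ _ _ 2])
        (use ints int b in auto)
  next
    case 3
    show False
      by (rule theta_face_aux[OF arcs(3,1,2) _ _ _ a(3,1,2) D(3,1,2) D(6,4,5) D(9,7,8) _ _ _ _ 3])
        (use ints int b in auto)
  qed
qed

section \<open>Theta subdivisions in plane drawings\<close>

fun path_edges :: "'v list \<Rightarrow> 'v set set" where
  "path_edges (x # y # xs) = insert {x, y} (path_edges (y # xs))"
| "path_edges _ = {}"

lemma path_edges_subset: "e \<in> path_edges xs \<Longrightarrow> e \<subseteq> set xs"
  by (induction xs rule: path_edges.induct) auto

lemma path_edges_doubleton:
  "distinct xs \<Longrightarrow> e \<in> path_edges xs \<Longrightarrow> \<exists>x y. x \<noteq> y \<and> e = {x, y}"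
  by (induction xs rule: path_edges.induct) auto

lemma path_edges_cover:
  assumes "1 < length xs" "x \<in> set xs"
  obtains e where "e \<in> path_edges xs" "x \<in> e"
  using assms
proof (induction xs arbitrary: thesis rule: path_edges.induct)
  case (1 y w ys)
  show ?case
  proof (cases "x = y \<or> x = w")
    case True
    then show ?thesis using "1.prems"(1)[of "{y, w}"] by auto
  next
    case False
    then have "1 < length (w # ys)" "x \<in> set (w # ys)" using "1.prems"(3) by (cases ys; simp)+
    then show ?thesis using "1.IH" "1.prems"(1) by (metis insertI2 path_edges.simps(1))
  qed
qed auto

definition drawn :: "('v set \<Rightarrow> real \<Rightarrow> complex) \<Rightarrow> 'v list \<Rightarrow> complex set"
  where "drawn crv xs = (\<Union>e\<in>path_edges xs. path_image (crv e))"

context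
  fixes X :: "'v hypergraph" and pos crv
  assumes draw: "plane_drawing X pos crv"
    and verts: "\<Union>(hedges X) \<subseteq> hverts X"
begin

lemma pos_inj:
  assumes "x \<in> e" "e \<in> hedges X" "y \<in> f" "f \<in> hedges X" "pos x = pos y"
  shows "x = y"
proof -
  have "inj_on pos (hverts X)" using draw by (simp add: plane_drawing_def)
  moreover have "x \<in> hverts X" "y \<in> hverts X" using assms verts by auto
  ultimately show ?thesis using assms(5) by (simp add: inj_on_eq_iff)
qed

lemma edge_arc_between:
  assumes "{x, y} \<in> hedges X"
  shows "arc_between (path_image (crv {x, y})) (pos x) (pos y)"
proof -
  have "arc (crv {x, y})" "{pathstart (crv {x, y}), pathfinish (crv {x, y})} = {pos x, pos y}"
    using draw assms unfolding plane_drawing_def by auto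
  then have "arc_between (path_image (crv {x, y})) (pos x) (pos y) \<or>
    arc_between (path_image (crv {x, y})) (pos y) (pos x)"
    unfolding arc_between_def doubleton_eq_iff by blast
  then show ?thesis using arc_between_commute by blast
qed

lemma edges_meet:
  assumes "e \<in> hedges X" "f \<in> hedges X" "e \<noteq> f"
  shows "path_image (crv e) \<inter> path_image (crv f) \<subseteq> pos ` (e \<inter> f)"
  using assms draw by (simp add: plane_drawing_def)

lemma drawn_meet:
  assumes "path_edges xs \<subseteq> hedges X" "path_edges ys \<subseteq> hedges X" "path_edges xs \<inter> path_edges ys = {}"
  shows "drawn crv xs \<inter> drawn crv ys \<subseteq> pos ` (set xs \<inter> set ys)"
proof
  fix z assume "z \<in> drawn crv xs \<inter> drawn crv ys"
  then obtain e f where ef: "e \<in> path_edges xs" "f \<in> path_edges ys"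
    "z \<in> path_image (crv e)" "z \<in> path_image (crv f)"
    unfolding drawn_def by blast
  then have "z \<in> pos ` (e \<inter> f)" using edges_meet[of e f] assms by blast
  then show "z \<in> pos ` (set xs \<inter> set ys)"
    using path_edges_subset[OF ef(1)] path_edges_subset[OF ef(2)] by blast
qed

lemma drawn_vertex:
  assumes "path_edges xs \<subseteq> hedges X" "1 < length xs" "x \<in> set xs"
  shows "pos x \<in> drawn crv xs"
  using assms
proof (induction xs rule: path_edges.induct)
  case (1 y w ys)
  have "pos y \<in> path_image (crv {y, w})" "pos w \<in> path_image (crv {y, w})"
    using arc_betweenD[OF edge_arc_between[of y w]] 1 by auto
  then show ?case using 1 by (cases ys) (auto simp: drawn_def)
qed auto

lemma drawn_arc_between:
  assumes "path_edges xs \<subseteq> hedges X" "1 < length xs" "distinct xs"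
  shows "arc_between (drawn crv xs) (pos (hd xs)) (pos (last xs))"
  using assms
proof (induction xs rule: path_edges.induct)
  case (1 x y ys)
  have e: "{x, y} \<in> hedges X" using 1 by auto
  show ?case
  proof (cases ys)
    case Nil
    then show ?thesis using edge_arc_between[OF e] by (simp add: drawn_def)
  next
    case (Cons z zs)
    have "drawn crv [x, y] \<inter> drawn crv (y # ys) \<subseteq> pos ` (set [x, y] \<inter> set (y # ys))"
    proof (rule drawn_meet)
      show "path_edges [x, y] \<inter> path_edges (y # ys) = {}"
        using path_edges_subset[of "{x, y}" "y # ys"] 1 by auto
    qed (use 1 in auto)
    also have "\<dots> = {pos y}" using 1 by auto
    finally have "arc_between (path_image (crv {x, y}) \<union> drawn crv (y # ys)) (pos x) (pos (last (y # ys)))"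
      using 1 Cons by (intro arc_between_join[OF edge_arc_between[OF e]]) (auto simp: drawn_def)
    then show ?thesis by (simp add: drawn_def)
  qed
qed auto

lemma drawn_connected:
  assumes "path_edges xs \<subseteq> hedges X"
  shows "connected (drawn crv xs)"
  using assms
proof (induction xs rule: path_edges.induct)
  case (1 x y ys)
  have e: "{x, y} \<in> hedges X" using 1 by auto
  note a = arc_betweenD[OF edge_arc_between[OF e]]
  show ?case
  proof (cases ys)
    case Nil
    then show ?thesis using a(5) by (simp add: drawn_def)
  next
    case (Cons z zs)
    then have "pos y \<in> drawn crv (y # ys)" using 1 by (intro drawn_vertex) auto
    moreover have "connected (drawn crv (y # ys))" using 1 by auto
    ultimately have "connected (path_image (crv {x, y}) \<union> drawn crv (y # ys))"
      using a(2,5) by (intro connected_Un) auto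
    then show ?thesis by (simp add: drawn_def)
  qed
qed (auto simp: drawn_def)

text \<open>The \<open>P i\<close> form the theta curve and the \<open>Q i\<close> tie
  \<open>b\<close> to it. The \<open>Q i\<close> may overlap each other, since
  \<open>theta_face\<close> only asks for connected sets. The condition on \<open>{u, v}\<close>
  excludes that two of the \<open>P i\<close> are the same single edge.\<close>

lemma no_theta_subdivision:
  assumes P: "\<And>i. i \<in> {1,2,3::nat} \<Longrightarrow> path_edges (P i) \<subseteq> hedges X \<and> distinct (P i) \<and>
      hd (P i) = u \<and> last (P i) = v \<and> a i \<in> set (P i) - {u, v}"
    and PP: "\<And>i j. i \<in> {1,2,3::nat} \<Longrightarrow> j \<in> {1,2,3} \<Longrightarrow> i < j \<Longrightarrow> set (P i) \<inter> set (P j) = {u, v}"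
    and uv: "{u, v} \<notin> hedges X"
    and Q: "\<And>i. i \<in> {1,2,3::nat} \<Longrightarrow> path_edges (Q i) \<subseteq> hedges X \<and>
      hd (Q i) = b \<and> last (Q i) = a i \<and> set (Q i) \<inter> (set (P 1) \<union> set (P 2) \<union> set (P 3)) = {a i}"
    and b: "b \<notin> set (P 1) \<union> set (P 2) \<union> set (P 3)"
  shows False
proof -
  let ?I = "{1,2,3::nat}"
  let ?S = "\<lambda>i. drawn crv (P i)" and ?D = "\<lambda>i. drawn crv (Q i)"
  have ends: "u \<in> set (P i)" "v \<in> set (P i)" "1 < length (P i)" if "i \<in> ?I" for i
  proof -
    have ne: "P i \<noteq> []" using P[OF that] by auto
    show "u \<in> set (P i)" "v \<in> set (P i)" using P[OF that] ne hd_in_set last_in_set by metis+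
    have "length (P i) \<noteq> 1" using P[OF that] by (auto simp: length_Suc_conv)
    then show "1 < length (P i)" using ne by (cases "P i") auto
  qed
  have Qends: "b \<in> set (Q i)" "a i \<in> set (Q i)" "1 < length (Q i)" if "i \<in> ?I" for i
  proof -
    have ne: "Q i \<noteq> []" using Q[OF that] by auto
    then show "b \<in> set (Q i)" "a i \<in> set (Q i)" using Q[OF that] hd_in_set last_in_set by metis+
    have "b \<noteq> a i" using b P[OF that] that by auto
    then have "length (Q i) \<noteq> 1" using Q[OF that] by (auto simp: length_Suc_conv)
    then show "1 < length (Q i)" using ne by (cases "Q i") auto
  qed
  \<comment> \<open>An arc has two different end points. This later rules out an edge shared by some
    \<open>Q i\<close> and some \<open>P j\<close>, whose ends would all be
    \<open>a i\<close>.\<close>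
  have edge_ends: "\<not> e \<subseteq> {x}" if "e \<in> hedges X" for e x
  proof
    assume "e \<subseteq> {x}"
    then have "pos ` e \<subseteq> {pos x}" by auto
    moreover have c: "arc (crv e)" "{pathstart (crv e), pathfinish (crv e)} = pos ` e"
      using draw that unfolding plane_drawing_def by auto
    ultimately have "{pathstart (crv e), pathfinish (crv e)} \<subseteq> {pos x}" by metis
    then show False using arc_distinct_ends[OF c(1)] by simp
  qed
  have vert: "\<exists>e \<in> hedges X. x \<in> e" if "path_edges xs \<subseteq> hedges X" "1 < length xs" "x \<in> set xs" for x xs
    using path_edges_cover[OF that(2,3)] that(1) by blast
  have arcs: "arc_between (?S i) (pos u) (pos v)" if "i \<in> ?I" for i
    using drawn_arc_between[of "P i"] P[OF that] ends[OF that] by auto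
  have ints: "?S i \<inter> ?S j = {pos u, pos v}" if ij: "i \<in> ?I" "j \<in> ?I" "i < j" for i j
  proof
    have "path_edges (P i) \<inter> path_edges (P j) = {}"
    proof (rule ccontr)
      assume "path_edges (P i) \<inter> path_edges (P j) \<noteq> {}"
      then obtain e where e: "e \<in> path_edges (P i)" "e \<in> path_edges (P j)" by blast
      then have "e \<subseteq> {u, v}" using path_edges_subset[OF e(1)] path_edges_subset[OF e(2)] PP[OF ij] by blast
      moreover obtain x y where "x \<noteq> y" "e = {x, y}" using path_edges_doubleton[OF _ e(1)] P[OF ij(1)] by blast
      ultimately have "e = {u, v}" by auto
      with e(1) P[OF ij(1)] uv show False by auto
    qed
    then have "?S i \<inter> ?S j \<subseteq> pos ` (set (P i) \<inter> set (P j))"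
      using P ij by (intro drawn_meet) auto
    then show "?S i \<inter> ?S j \<subseteq> {pos u, pos v}" using PP[OF ij] by auto
    show "{pos u, pos v} \<subseteq> ?S i \<inter> ?S j" using arc_betweenD(1,2)[OF arcs] ij by auto
  qed
  have apos: "pos (a i) \<in> ?S i - {pos u, pos v}" if i: "i \<in> ?I" for i
  proof -
    have p: "path_edges (P i) \<subseteq> hedges X" "a i \<in> set (P i)" "a i \<noteq> u" "a i \<noteq> v" using P[OF i] by auto
    have "pos (a i) \<noteq> pos w" if w: "w \<in> {u, v}" for w
    proof -
      have "w \<in> set (P i)" "w \<noteq> a i" using w ends[OF i] p by auto
      then show ?thesis using vert[OF p(1) ends(3)[OF i]] pos_inj p(2) by metis
    qed
    then show ?thesis using drawn_vertex[OF p(1) ends(3)[OF i] p(2)] by auto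
  qed
  have meet: "?D i \<inter> ?S j \<subseteq> {pos (a i)}" if i: "i \<in> ?I" and j: "j \<in> ?I" for i j
  proof -
    have QP: "set (Q i) \<inter> set (P j) \<subseteq> {a i}" using Q[OF i] j by auto
    have "path_edges (Q i) \<inter> path_edges (P j) = {}"
    proof (rule ccontr)
      assume "path_edges (Q i) \<inter> path_edges (P j) \<noteq> {}"
      then obtain e where e: "e \<in> path_edges (Q i)" "e \<in> path_edges (P j)" by blast
      then have "e \<subseteq> {a i}" using path_edges_subset[OF e(1)] path_edges_subset[OF e(2)] QP by blast
      then show False using edge_ends e(1) Q[OF i] by blast
    qed
    then have "?D i \<inter> ?S j \<subseteq> pos ` (set (Q i) \<inter> set (P j))"
      using P Q i j by (intro drawn_meet) auto
    then show ?thesis using QP by auto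
  qed
  have aD: "pos (a i) \<in> ?D i" and bD: "pos b \<in> ?D i" if "i \<in> ?I" for i
    using drawn_vertex[of "Q i"] Q[OF that] Qends[OF that] by auto
  have D: "?D i \<inter> (?S 1 \<union> ?S 2 \<union> ?S 3) = {pos (a i)}" if i: "i \<in> ?I" for i
    using meet[OF i, of 1] meet[OF i, of 2] meet[OF i, of 3] aD[OF i] apos[OF i] i by auto
  have bS: "pos b \<notin> ?S 1 \<union> ?S 2 \<union> ?S 3"
  proof
    assume "pos b \<in> ?S 1 \<union> ?S 2 \<union> ?S 3"
    then have "pos b = pos (a 1)" using D[of 1] bD[of 1] by blast
    then have "b = a 1"
      using vert[of "Q 1"] Q[of 1] Qends[of 1] pos_inj by (metis insertI1)
    then show False using b P[of 1] by auto
  qed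
  show False
  proof (rule theta_face)
    show "arc_between (?S 1) (pos u) (pos v)" "arc_between (?S 2) (pos u) (pos v)"
      "arc_between (?S 3) (pos u) (pos v)"
      by (rule arcs, simp)+
    show "?S 1 \<inter> ?S 2 = {pos u, pos v}" "?S 1 \<inter> ?S 3 = {pos u, pos v}"
      "?S 2 \<inter> ?S 3 = {pos u, pos v}"
      by (rule ints; simp)+
    show "pos (a 1) \<in> ?S 1 - {pos u, pos v}" "pos (a 2) \<in> ?S 2 - {pos u, pos v}"
      "pos (a 3) \<in> ?S 3 - {pos u, pos v}"
      by (rule apos, simp)+
    show "connected (?D 1)" "connected (?D 2)" "connected (?D 3)"
      by (rule drawn_connected, use Q in simp)+
    show "pos b \<in> ?D 1" "pos b \<in> ?D 2" "pos b \<in> ?D 3"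
      "pos (a 1) \<in> ?D 1" "pos (a 2) \<in> ?D 2" "pos (a 3) \<in> ?D 3"
      by (rule aD bD, simp)+
    show "?D 1 \<inter> (?S 1 \<union> ?S 2 \<union> ?S 3) = {pos (a 1)}" "?D 2 \<inter> (?S 1 \<union> ?S 2 \<union> ?S 3) = {pos (a 2)}"
      "?D 3 \<inter> (?S 1 \<union> ?S 2 \<union> ?S 3) = {pos (a 3)}"
      by (rule D, simp)+
    show "pos b \<notin> ?S 1 \<union> ?S 2 \<union> ?S 3" by (rule bS)
  qed
qed

end

section \<open>Planarity of subgraphs and of sub-hypergraphs\<close>

lemma planar_graph_embed:
  assumes "planar_graph X" "inj_on f (hverts Y)" "f ` hverts Y \<subseteq> hverts X"
    and "\<And>e. e \<in> hedges Y \<Longrightarrow> e \<subseteq> hverts Y \<and> f ` e \<in> hedges X"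
  shows "planar_graph Y"
proof -
  obtain pos crv where "plane_drawing X pos crv"
    using assms(1) unfolding planar_graph_def by blast
  then have inj: "inj_on pos (hverts X)"
    and edge: "\<And>e. e \<in> hedges X \<Longrightarrow> arc (crv e) \<and>
       {pathstart (crv e), pathfinish (crv e)} = pos ` e \<and>
       path_image (crv e) \<inter> pos ` hverts X = pos ` e"
    and meet: "\<And>e g. e \<in> hedges X \<Longrightarrow> g \<in> hedges X \<Longrightarrow> e \<noteq> g \<Longrightarrow>
       path_image (crv e) \<inter> path_image (crv g) \<subseteq> pos ` (e \<inter> g)"
    by (simp_all add: plane_drawing_def)
  have "plane_drawing Y (pos \<circ> f) (\<lambda>e. crv (f ` e))"
    unfolding plane_drawing_def
  proof (intro conjI ballI impI)
    show "inj_on (pos \<circ> f) (hverts Y)"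
      using assms(2,3) inj by (meson comp_inj_on inj_on_subset)
  next
    fix e assume e: "e \<in> hedges Y"
    note fe = edge[OF conjunct2[OF assms(4)[OF e]]]
    show "arc (crv (f ` e))" using fe by blast
    show "{pathstart (crv (f ` e)), pathfinish (crv (f ` e))} = (pos \<circ> f) ` e"
      using fe unfolding image_comp by simp
    have "pos ` f ` e \<subseteq> pos ` f ` hverts Y" "pos ` f ` hverts Y \<subseteq> pos ` hverts X"
      using assms(3) assms(4)[OF e] by (simp_all add: image_mono)
    moreover have "path_image (crv (f ` e)) \<inter> pos ` hverts X = pos ` f ` e" using fe by simp
    ultimately have "path_image (crv (f ` e)) \<inter> pos ` f ` hverts Y = pos ` f ` e" by blast
    then show "path_image (crv (f ` e)) \<inter> (pos \<circ> f) ` hverts Y = (pos \<circ> f) ` e"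
      unfolding image_comp .
  next
    fix e g assume e: "e \<in> hedges Y" and g: "g \<in> hedges Y" and "e \<noteq> g"
    then have "f ` e \<noteq> f ` g" using assms(2,4) by (meson inj_on_image_eq_iff)
    then have "path_image (crv (f ` e)) \<inter> path_image (crv (f ` g)) \<subseteq> pos ` (f ` e \<inter> f ` g)"
      using assms(4)[OF e] assms(4)[OF g] by (intro meet) auto
    also have "f ` e \<inter> f ` g = f ` (e \<inter> g)"
      using assms(2,4) e g by (metis inj_on_image_Int)
    finally show "path_image (crv (f ` e)) \<inter> path_image (crv (f ` g)) \<subseteq> (pos \<circ> f) ` (e \<inter> g)"
      unfolding image_comp .
  qed
  then show ?thesis unfolding planar_graph_def by blast
qed

text \<open>Vertices and hyperedges of \<open>X\<close> may be dropped, but those hyperedges that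
  remain keep all their elements. Hence \<open>map_sum f (image f)\<close> sends incidences to
  incidences. The lemma serves both to find obstructions in a hypergraph and to transport planarity
  along bijections.\<close>

lemma planar_hypergraph_embed:
  assumes "planar_hypergraph X" "inj_on f (hverts Y)" "f ` hverts Y \<subseteq> hverts X"
    and edges: "\<And>e. e \<in> hedges Y \<Longrightarrow> e \<subseteq> hverts Y \<and> f ` e \<in> hedges X"
  shows "planar_hypergraph Y"
  unfolding planar_hypergraph_def
proof (rule planar_graph_embed)
  let ?g = "map_sum f (image f)"
  have sub: "h \<subseteq> hverts Y" and img: "f ` h \<in> hedges X" if "h \<in> hedges Y" for h
    using edges[OF that] by simp_all
  show "planar_graph (incidence_graph X)" using assms(1) by (simp add: planar_hypergraph_def)
  show "inj_on ?g (hverts (incidence_graph Y))"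
  proof (rule inj_onI)
    fix x y assume xy: "x \<in> hverts (incidence_graph Y)" "y \<in> hverts (incidence_graph Y)" "?g x = ?g y"
    show "x = y"
    proof (cases x)
      case (Inl v)
      with xy(3) obtain w where w: "y = Inl w" "f v = f w" by (cases y) simp_all
      then have "v \<in> hverts Y" "w \<in> hverts Y" using xy Inl by (simp_all add: incidence_graph_def InlI Plus_def image_iff)
      then show ?thesis using Inl w inj_onD[OF assms(2)] by simp
    next
      case (Inr h)
      with xy(3) obtain k where k: "y = Inr k" "f ` h = f ` k" by (cases y) simp_all
      then have "h \<in> hedges Y" "k \<in> hedges Y" using xy Inr by (simp_all add: incidence_graph_def Plus_def image_iff)
      then show ?thesis using Inr k inj_on_image_eq_iff[OF assms(2) sub sub] by simp
    qed
  qed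
  show "?g ` hverts (incidence_graph Y) \<subseteq> hverts (incidence_graph X)"
  proof
    fix x assume "x \<in> ?g ` hverts (incidence_graph Y)"
    then consider v where "x = Inl (f v)" "v \<in> hverts Y" | h where "x = Inr (f ` h)" "h \<in> hedges Y"
      by (auto simp: incidence_graph_def)
    then show "x \<in> hverts (incidence_graph X)"
      using assms(3) img by cases (auto simp: incidence_graph_def)
  qed
  fix e assume "e \<in> hedges (incidence_graph Y)"
  then obtain v h where e: "e = {Inl v, Inr h}" "v \<in> hverts Y" "h \<in> hedges Y" "v \<in> h"
    unfolding incidence_graph_def by auto
  have "f v \<in> hverts X" "f v \<in> f ` h" using assms(3) e by blast+
  then have "?g ` e \<in> hedges (incidence_graph X)"
    using e img[OF e(3)] by (auto simp: incidence_graph_def)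
  moreover have "e \<subseteq> hverts (incidence_graph Y)"
    using e by (simp add: incidence_graph_def InlI InrI)
  ultimately show "e \<subseteq> hverts (incidence_graph Y) \<and> ?g ` e \<in> hedges (incidence_graph X)"
    by simp
qed

lemma Inl_Inr_edge_iff [simp]:
  "{Inl v, Inr h} \<in> hedges (incidence_graph X) \<longleftrightarrow> v \<in> hverts X \<and> h \<in> hedges X \<and> v \<in> h"
  "{Inr h, Inl v} \<in> hedges (incidence_graph X) \<longleftrightarrow> v \<in> hverts X \<and> h \<in> hedges X \<and> v \<in> h"
  by (auto simp: incidence_graph_def doubleton_eq_iff)

lemma Inl_Inl_not_edge [simp]: "{Inl u, Inl v} \<notin> hedges (incidence_graph X)"
  by (auto simp: incidence_graph_def doubleton_eq_iff)

text \<open>Both ends of the theta are vertices of the hypergraph, hence not adjacent in the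
  bipartite incidence graph, whereas \<open>b\<close> and the \<open>a\<close>'s may also be
  hyperedges. The conditions range over an explicit set of triples, so that for concrete paths they
  are checked by enumeration.\<close>

lemma theta_not_planar_hypergraph:
  fixes X :: "'v hypergraph"
  assumes P: "\<And>P a Q. (P, a, Q) \<in> {(P1, a1, Q1), (P2, a2, Q2), (P3, a3, Q3)} \<Longrightarrow>
      path_edges P \<subseteq> hedges (incidence_graph X) \<and> distinct P \<and>
      hd P = Inl u \<and> last P = Inl v \<and> a \<in> set P - {Inl u, Inl v} \<and>
      path_edges Q \<subseteq> hedges (incidence_graph X) \<and>
      hd Q = b \<and> last Q = a \<and> set Q \<inter> (set P1 \<union> set P2 \<union> set P3) = {a}"
    and PP: "set P1 \<inter> set P2 = {Inl u, Inl v}" "set P1 \<inter> set P3 = {Inl u, Inl v}"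
      "set P2 \<inter> set P3 = {Inl u, Inl v}"
    and b: "b \<notin> set P1 \<union> set P2 \<union> set P3"
  shows "\<not> planar_hypergraph X"
proof
  assume "planar_hypergraph X"
  then obtain pos crv where d: "plane_drawing (incidence_graph X) pos crv"
    unfolding planar_hypergraph_def planar_graph_def by blast
  have sub: "\<Union>(hedges (incidence_graph X)) \<subseteq> hverts (incidence_graph X)"
    by (auto simp: incidence_graph_def)
  define P where "P = (\<lambda>i::nat. if i = 1 then P1 else if i = 2 then P2 else P3)"
  define a where "a = (\<lambda>i::nat. if i = 1 then a1 else if i = 2 then a2 else a3)"
  define Q where "Q = (\<lambda>i::nat. if i = 1 then Q1 else if i = 2 then Q2 else Q3)"
  have tri: "(P i, a i, Q i) \<in> {(P1, a1, Q1), (P2, a2, Q2), (P3, a3, Q3)}" for i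
    by (simp add: P_def a_def Q_def)
  have un: "set (P 1) \<union> set (P 2) \<union> set (P 3) = set P1 \<union> set P2 \<union> set P3"
    by (simp add: P_def)
  show False
  proof (rule no_theta_subdivision[OF d sub, where P = P and Q = Q and a = a and b = b and u = "Inl u" and v = "Inl v"])
    show "path_edges (P i) \<subseteq> hedges (incidence_graph X) \<and> distinct (P i) \<and>
      hd (P i) = Inl u \<and> last (P i) = Inl v \<and> a i \<in> set (P i) - {Inl u, Inl v}" for i
      using P[OF tri[of i]] by blast
    show "set (P i) \<inter> set (P j) = {Inl u, Inl v}"
      if "i \<in> {1,2,3::nat}" "j \<in> {1,2,3}" "i < j" for i j
      using that PP by (auto simp: P_def)
    show "path_edges (Q i) \<subseteq> hedges (incidence_graph X) \<and> hd (Q i) = b \<and> last (Q i) = a i \<and>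
      set (Q i) \<inter> (set (P 1) \<union> set (P 2) \<union> set (P 3)) = {a i}" for i
      using P[OF tri[of i]] unfolding un by blast
    show "b \<notin> set (P 1) \<union> set (P 2) \<union> set (P 3)" using b unfolding un .
  qed simp
qed

section \<open>Four non-planar hypergraphs\<close>

text \<open>In the next four hypergraphs the numbers stand for divisors of \<open>n\<close>. For exponents at least
  3 and 3: \<open>i\<close> and \<open>3 + i\<close> are the \<open>i + 1\<close>-st powers of the two primes.\<close>

lemma not_planar_two_primes:
  "\<not> planar_hypergraph ({0,1,2,3,4,5::nat},
     {{0,3}, {0,4}, {0,5}, {1,3}, {1,4}, {1,5}, {2,3}, {2,4}, {2,5}})" (is "\<not> planar_hypergraph ?X")
proof (rule theta_not_planar_hypergraph)
  \<comment> \<open>The six powers are the branch vertices, the hyperedges subdivide the nine edges.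
    The ends of the theta are two powers of one prime, and the third power of that prime is
    \<open>b\<close>.\<close>
  let ?P = "\<lambda>i. [Inl 3, Inr {i,3}, Inl i, Inr {i,4}, Inl 4] :: (nat + nat set) list"
  let ?Q = "\<lambda>i. [Inl 5, Inr {i,5}, Inl i] :: (nat + nat set) list"
  show "path_edges P \<subseteq> hedges (incidence_graph ?X) \<and> distinct P \<and> hd P = Inl 3 \<and> last P = Inl 4 \<and>
    a \<in> set P - {Inl 3, Inl 4} \<and> path_edges Q \<subseteq> hedges (incidence_graph ?X) \<and> hd Q = Inl 5 \<and>
    last Q = a \<and> set Q \<inter> (set (?P 0) \<union> set (?P 1) \<union> set (?P 2)) = {a}"
    if "(P, a, Q) \<in> {(?P 0, Inl 0, ?Q 0), (?P 1, Inl 1, ?Q 1), (?P 2, Inl 2, ?Q 2)}" for P a Q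
    using that by (elim insertE emptyE) (simp_all add: set_eq_subset)
qed (simp_all add: set_eq_subset)

text \<open>Exponent at least 3 of \<open>p\<close>: \<open>0 = q\<close>, \<open>1 = r\<close>, \<open>2 = q r\<close>, and 3, 4, 5 are powers of \<open>p\<close>.\<close>

lemma not_planar_cube:
  "\<not> planar_hypergraph ({0,1,2,3,4,5::nat}, {{3,0,1}, {4,0,1}, {5,0,1}, {3,2}, {4,2}, {5,2}})"
  (is "\<not> planar_hypergraph ?X")
proof (rule theta_not_planar_hypergraph)
  \<comment> \<open>The sides of the K(3,3) are the vertices 0, 1, 2 and the hyperedges
    \<open>{i,0,1}\<close>; vertex 2 reaches such a hyperedge through \<open>{i,2}\<close> and the
    power \<open>i\<close>.\<close>
  let ?P = "\<lambda>i. [Inl 0, Inr {i,0,1}, Inl 1] :: (nat + nat set) list"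
  let ?Q = "\<lambda>i. [Inl 2, Inr {i,2}, Inl i, Inr {i,0,1}] :: (nat + nat set) list"
  show "path_edges P \<subseteq> hedges (incidence_graph ?X) \<and> distinct P \<and> hd P = Inl 0 \<and> last P = Inl 1 \<and>
    a \<in> set P - {Inl 0, Inl 1} \<and> path_edges Q \<subseteq> hedges (incidence_graph ?X) \<and> hd Q = Inl 2 \<and>
    last Q = a \<and> set Q \<inter> (set (?P 3) \<union> set (?P 4) \<union> set (?P 5)) = {a}"
    if "(P, a, Q) \<in> {(?P 3, Inr {3,0,1}, ?Q 3), (?P 4, Inr {4,0,1}, ?Q 4), (?P 5, Inr {5,0,1}, ?Q 5)}"
    for P a Q
    using that by (elim insertE emptyE) (simp_all add: set_eq_subset)
qed (simp_all add: set_eq_subset)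

text \<open>Exponents at least 2 of \<open>p\<close> and \<open>q\<close>: 0, 1 are powers of \<open>p\<close>; 2, 3 are powers of \<open>q\<close>;
  \<open>4 = r\<close>, \<open>5 = p r\<close>, \<open>6 = q r\<close>.\<close>

lemma not_planar_two_squares:
  "\<not> planar_hypergraph ({0,1,2,3,4,5,6::nat},
     {{0,2,4}, {0,3,4}, {1,2,4}, {1,3,4}, {0,6}, {1,6}, {2,5}, {3,5}})" (is "\<not> planar_hypergraph ?X")
proof (rule theta_not_planar_hypergraph)
  \<comment> \<open>One side of the K(3,3) consists of 0, 2 and the hyperedge
    \<open>{1,3,4}\<close>, the other of 1, 3 and the hyperedge \<open>{0,2,4}\<close>. The detours
    through 6 and 5 join the two powers of the same prime.\<close>
  let ?P1 = "[Inl 0, Inr {0,2,4}, Inl 2] :: (nat + nat set) list"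
  let ?P2 = "[Inl 0, Inr {0,6}, Inl 6, Inr {1,6}, Inl 1, Inr {1,2,4}, Inl 2] :: (nat + nat set) list"
  let ?P3 = "[Inl 0, Inr {0,3,4}, Inl 3, Inr {3,5}, Inl 5, Inr {2,5}, Inl 2] :: (nat + nat set) list"
  let ?b = "Inr {1,3,4} :: nat + nat set"
  show "path_edges P \<subseteq> hedges (incidence_graph ?X) \<and> distinct P \<and> hd P = Inl 0 \<and> last P = Inl 2 \<and>
    a \<in> set P - {Inl 0, Inl 2} \<and> path_edges Q \<subseteq> hedges (incidence_graph ?X) \<and> hd Q = ?b \<and>
    last Q = a \<and> set Q \<inter> (set ?P1 \<union> set ?P2 \<union> set ?P3) = {a}"
    if "(P, a, Q) \<in> {(?P1, Inr {0,2,4}, [?b, Inl 4, Inr {0,2,4}]), (?P2, Inl 1, [?b, Inl 1]),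
      (?P3, Inl 3, [?b, Inl 3])}" for P a Q
    using that by (elim insertE emptyE) (simp_all add: set_eq_subset)
qed (simp_all add: set_eq_subset)

text \<open>At least four primes, with \<open>s\<close> the product of all primes but three: \<open>0 = p\<close>, \<open>1 = q\<close>,
  \<open>2 = r\<close>, \<open>3 = s\<close>, \<open>4 = p q\<close>, \<open>5 = r s\<close>, \<open>6 = q s\<close>, \<open>7 = p s\<close>, \<open>8 = q r\<close>, \<open>9 = p r\<close>.\<close>

lemma not_planar_four_primes:
  "\<not> planar_hypergraph ({0,1,2,3,4,5,6,7,8,9::nat},
     {{0,1,5}, {2,3,4}, {0,2,6}, {1,2,7}, {0,3,8}, {1,3,9}, {4,5}})" (is "\<not> planar_hypergraph ?X")
proof (rule theta_not_planar_hypergraph)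
  \<comment> \<open>One side of the K(3,3) consists of 0, 1 and the hyperedge
    \<open>{2,3,4}\<close>, the other of 2, 3 and the hyperedge \<open>{0,1,5}\<close>. The two
    hyperedges are linked through the complementary vertices 4 and 5.\<close>
  let ?P1 = "[Inl 0, Inr {0,1,5}, Inl 1] :: (nat + nat set) list"
  let ?P2 = "[Inl 0, Inr {0,2,6}, Inl 2, Inr {1,2,7}, Inl 1] :: (nat + nat set) list"
  let ?P3 = "[Inl 0, Inr {0,3,8}, Inl 3, Inr {1,3,9}, Inl 1] :: (nat + nat set) list"
  let ?b = "Inr {2,3,4} :: nat + nat set"
  show "path_edges P \<subseteq> hedges (incidence_graph ?X) \<and> distinct P \<and> hd P = Inl 0 \<and> last P = Inl 1 \<and>
    a \<in> set P - {Inl 0, Inl 1} \<and> path_edges Q \<subseteq> hedges (incidence_graph ?X) \<and> hd Q = ?b \<and>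
    last Q = a \<and> set Q \<inter> (set ?P1 \<union> set ?P2 \<union> set ?P3) = {a}"
    if "(P, a, Q) \<in> {(?P1, Inr {0,1,5}, [?b, Inl 4, Inr {4,5}, Inl 5, Inr {0,1,5}]),
      (?P2, Inl 2, [?b, Inl 2]), (?P3, Inl 3, [?b, Inl 3])}" for P a Q
    using that by (elim insertE emptyE) (simp_all add: set_eq_subset)
qed (simp_all add: set_eq_subset)

section \<open>Straight-line drawings\<close>

text \<open>Hyperedges are indexed by \<open>K\<close>, so that their positions can be given by a
  formula in the index. By \<open>cover\<close> every drawn point is the end of some segment; thus
  \<open>sep\<close>, a condition on pairs of segments only, also keeps segments away from foreign
  vertices.\<close>

lemma straight_line_planar_hypergraph:
  fixes V :: "'v set" and K :: "'k set" and h :: "'k \<Rightarrow> 'v set"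
    and pv :: "'v \<Rightarrow> complex" and pk :: "'k \<Rightarrow> complex"
  assumes h: "inj_on h K"
    and inj: "inj_on pv V" "inj_on pk K" "\<And>v k. v \<in> V \<Longrightarrow> k \<in> K \<Longrightarrow> pv v \<noteq> pk k"
    and cover: "\<And>v. v \<in> V \<Longrightarrow> \<exists>k\<in>K. v \<in> h k" "\<And>k. k \<in> K \<Longrightarrow> \<exists>v\<in>V. v \<in> h k"
    and sep: "\<And>v k w l z. \<lbrakk>v \<in> V; k \<in> K; v \<in> h k; w \<in> V; l \<in> K; w \<in> h l;
        z \<in> closed_segment (pv v) (pk k); z \<in> closed_segment (pv w) (pk l)\<rbrakk>
      \<Longrightarrow> v = w \<and> k = l \<or> v = w \<and> z = pv v \<or> k = l \<and> z = pk k"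
  shows "planar_hypergraph (V, h ` K)"
proof -
  let ?X = "incidence_graph (V, h ` K)"
  define pos where "pos = case_sum pv (\<lambda>e. pk (the_inv_into K h e))"
  \<comment> \<open>An edge is an unordered pair; \<open>isl\<close> singles out its hypergraph
    vertex, which becomes the start of the segment.\<close>
  define crv where "crv e = linepath (pos (SOME x. x \<in> e \<and> isl x)) (pos (SOME x. x \<in> e \<and> \<not> isl x))" for e
  have pos: "pos (Inl v) = pv v" "k \<in> K \<Longrightarrow> pos (Inr (h k)) = pk k" for v k
    by (simp_all add: pos_def the_inv_into_f_f[OF h])
  have crv: "crv {Inl v, Inr (h k)} = linepath (pv v) (pk k)" if "k \<in> K" for v k
  proof -
    have "(SOME x. x \<in> {Inl v, Inr (h k)} \<and> isl x) = Inl v"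
      "(SOME x. x \<in> {Inl v, Inr (h k)} \<and> \<not> isl x) = Inr (h k)"
      by (rule some_equality; auto)+
    then show ?thesis using that by (simp add: crv_def pos)
  qed
  have edgeE: "\<exists>v k. e = {Inl v, Inr (h k)} \<and> v \<in> V \<and> k \<in> K \<and> v \<in> h k" if "e \<in> hedges ?X" for e
    using that by (auto simp: incidence_graph_def)
  have vsep: "w = v" if a: "v \<in> V" "k \<in> K" "v \<in> h k" "w \<in> V" "pv w \<in> closed_segment (pv v) (pk k)" for v k w
  proof -
    obtain l where "l \<in> K" "w \<in> h l" using cover(1)[OF a(4)] by blast
    with sep[of v k w l "pv w"] a inj(3)[of w k] show ?thesis by auto
  qed
  have ksep: "l = k" if a: "v \<in> V" "k \<in> K" "v \<in> h k" "l \<in> K" "pk l \<in> closed_segment (pv v) (pk k)" for v k l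
  proof -
    obtain w where "w \<in> V" "w \<in> h l" using cover(2)[OF a(4)] by blast
    with sep[of v k w l "pk l"] a inj(3)[of v l] show ?thesis by auto
  qed
  have verts: "hverts ?X = Inl ` V \<union> Inr ` h ` K" by (auto simp: incidence_graph_def)
  have pverts: "pos ` hverts ?X = pv ` V \<union> pk ` K"
    unfolding verts image_Un image_image using pos by (simp cong: image_cong)
  have "plane_drawing ?X pos crv"
    unfolding plane_drawing_def
  proof (intro conjI ballI impI)
    show "inj_on pos (hverts ?X)"
    proof (rule inj_onI)
      fix x y assume "x \<in> hverts ?X" "y \<in> hverts ?X" and eq: "pos x = pos y"
      then have x: "(\<exists>v\<in>V. x = Inl v) \<or> (\<exists>k\<in>K. x = Inr (h k))"
        and y: "(\<exists>v\<in>V. y = Inl v) \<or> (\<exists>k\<in>K. y = Inr (h k))"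
        unfolding verts by blast+
      from x show "x = y"
      proof (elim disjE bexE)
        fix v assume v: "v \<in> V" "x = Inl v"
        from y show ?thesis
        proof (elim disjE bexE)
          fix w assume "w \<in> V" "y = Inl w"
          then show ?thesis using v eq inj_onD[OF inj(1), of v w] by (simp add: pos)
        next
          fix k assume "k \<in> K" "y = Inr (h k)"
          then show ?thesis using v eq inj(3)[of v k] by (simp add: pos)
        qed
      next
        fix k assume k: "k \<in> K" "x = Inr (h k)"
        from y show ?thesis
        proof (elim disjE bexE)
          fix v assume "v \<in> V" "y = Inl v"
          then show ?thesis using k eq inj(3)[of v k] by (simp add: pos)
        next
          fix l assume "l \<in> K" "y = Inr (h l)"
          then show ?thesis using k eq inj_onD[OF inj(2), of k l] by (simp add: pos)
        qed
      qed
    qed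
  next
    fix e assume "e \<in> hedges ?X"
    then obtain v k where e: "e = {Inl v, Inr (h k)}" "v \<in> V" "k \<in> K" "v \<in> h k"
      using edgeE by blast
    have pe: "pos ` e = {pv v, pk k}" using e by (simp add: pos)
    show "arc (crv e)" using e inj(3) by (simp add: crv arc_linepath)
    show "{pathstart (crv e), pathfinish (crv e)} = pos ` e"
      unfolding pe using e by (simp add: crv)
    show "path_image (crv e) \<inter> pos ` hverts ?X = pos ` e"
      unfolding pverts pe using e vsep[OF e(2,3,4)] ksep[OF e(2,3,4)]
      by (auto simp: crv)
  next
    fix e f assume "e \<in> hedges ?X" "f \<in> hedges ?X" and ne: "e \<noteq> f"
    obtain v k where e: "e = {Inl v, Inr (h k)}" "v \<in> V" "k \<in> K" "v \<in> h k"
      using edgeE[OF \<open>e \<in> hedges ?X\<close>] by blast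
    obtain w l where f: "f = {Inl w, Inr (h l)}" "w \<in> V" "l \<in> K" "w \<in> h l"
      using edgeE[OF \<open>f \<in> hedges ?X\<close>] by blast
    show "path_image (crv e) \<inter> path_image (crv f) \<subseteq> pos ` (e \<inter> f)"
    proof
      fix z assume "z \<in> path_image (crv e) \<inter> path_image (crv f)"
      then have "z \<in> closed_segment (pv v) (pk k)" "z \<in> closed_segment (pv w) (pk l)"
        using e f by (simp_all add: crv)
      from sep[OF e(2-4) f(2-4) this] ne e f consider
        "Inl v \<in> e \<inter> f" "z = pos (Inl v)" | "Inr (h k) \<in> e \<inter> f" "z = pos (Inr (h k))"
        by (auto simp: pos)
      then show "z \<in> pos ` (e \<inter> f)" by cases blast+
    qed
  qed
  then show ?thesis unfolding planar_hypergraph_def planar_graph_def by blast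
qed

lemma in_closed_segment_complexD:
  assumes "z \<in> closed_segment a b"
  shows "\<exists>t. 0 \<le> t \<and> t \<le> 1 \<and> Re z = (1 - t) * Re a + t * Re b \<and> Im z = (1 - t) * Im a + t * Im b"
  using assms by (auto simp: closed_segment_def)

text \<open>The vertex \<open>(i, j)\<close> stands for \<open>p\<^sup>i q\<^sup>j\<close>. The vertices \<open>(i, 0)\<close> lie on the imaginary axis,
  \<open>(0, 1)\<close> and \<open>(0, 2)\<close> at \<open>-1\<close> and \<open>1\<close>, and every hyperedge is the midpoint of its two vertices.\<close>

lemma planar_two_primes:
  "planar_hypergraph ({(i, 0) | i. 0 < i} \<union> {(0, 1), (0, 2)},
     (\<lambda>(i, j). {(i, 0), (0, j)}) ` ({i::nat. 0 < i} \<times> {1, 2::nat}))"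
proof -
  define \<sigma> :: "nat \<Rightarrow> real" where "\<sigma> j = (if j = 1 then -1 else 1)" for j
  define pv :: "nat \<times> nat \<Rightarrow> complex"
    where "pv = (\<lambda>(i, j). if j = 0 then Complex 0 i else Complex (\<sigma> j) 0)"
  define pk :: "nat \<times> nat \<Rightarrow> complex"
    where "pk = (\<lambda>(i, j). Complex (\<sigma> j / 2) (i / 2))"
  let ?V = "{(i, 0) | i. 0 < i} \<union> {(0, 1), (0, 2)} :: (nat \<times> nat) set"
  let ?K = "{i::nat. 0 < i} \<times> {1, 2::nat}"
  let ?h = "\<lambda>(i, j). {(i, 0), (0, j)} :: (nat \<times> nat) set"
  show ?thesis
  proof (rule straight_line_planar_hypergraph[where pv = pv and pk = pk])
    show "inj_on ?h ?K" by (auto simp: inj_on_def doubleton_eq_iff)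
    show "inj_on pv ?V" "inj_on pk ?K"
      by (auto simp: inj_on_def pv_def pk_def \<sigma>_def split: if_splits)
    show "pv v \<noteq> pk k" if "v \<in> ?V" "k \<in> ?K" for v k
      using that by (auto simp: pv_def pk_def \<sigma>_def)
    show "\<exists>k\<in>?K. v \<in> ?h k" if v: "v \<in> ?V" for v
    proof -
      consider i where "v = (i, 0)" "0 < i" | j where "v = (0, j)" "j \<in> {1, 2}" using v by auto
      then show ?thesis
      proof cases
        case 1
        then show ?thesis by (intro bexI[of _ "(i, 1)"]) auto
      next
        case 2
        then show ?thesis by (intro bexI[of _ "(1, j)"]) auto
      qed
    qed
    show "\<exists>v\<in>?V. v \<in> ?h k" if "k \<in> ?K" for k
      using that by (intro bexI[of _ "(fst k, 0)"]) auto
    fix v k w l z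
    assume v: "v \<in> ?V" "k \<in> ?K" "v \<in> ?h k" and w: "w \<in> ?V" "l \<in> ?K" "w \<in> ?h l"
      and z: "z \<in> closed_segment (pv v) (pk k)" "z \<in> closed_segment (pv w) (pk l)"
    \<comment> \<open>The segments of \<open>(i, 0)\<close> and \<open>(0, j)\<close> to their
      midpoint lie on one line, from height \<open>i\<close> on the imaginary axis to the point
      \<open>\<sigma> j\<close>. The number \<open>\<sigma> j * Re z\<close> measures the progress
      along it, and 1/2 separates the two halves.\<close>
    have seg: "Im z = i * (1 - \<sigma> j * Re z) \<and> 0 \<le> \<sigma> j * Re z \<and> \<sigma> j * Re z \<le> 1 \<and>
        (if v = (i, 0) then \<sigma> j * Re z \<le> 1/2 else 1/2 \<le> \<sigma> j * Re z)"
      if v: "(i, j) \<in> ?K" "v \<in> ?h (i, j)" and z: "z \<in> closed_segment (pv v) (pk (i, j))" for v i j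
    proof -
      obtain t where t: "0 \<le> t" "t \<le> 1" "Re z = (1 - t) * Re (pv v) + t * Re (pk (i, j))"
        "Im z = (1 - t) * Im (pv v) + t * Im (pk (i, j))"
        using in_closed_segment_complexD[OF z] by blast
      have \<sigma>: "\<sigma> j * \<sigma> j = 1" by (simp add: \<sigma>_def)
      consider "v = (i, 0)" | "v = (0, j)" "v \<noteq> (i, 0)" "j \<noteq> 0" using v by auto
      then show ?thesis
      proof cases
        case 1
        then have z: "Re z = t * (\<sigma> j / 2)" "Im z = i * (1 - t / 2)"
          using t by (simp_all add: pv_def pk_def algebra_simps)
        have X: "\<sigma> j * Re z = t / 2" unfolding z by (simp add: \<sigma>_def)
        show ?thesis using 1 t(1,2) unfolding X z(2) by simp
      next
        case 2
        then have z: "Re z = (1 - t / 2) * \<sigma> j" "Im z = i * (t / 2)"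
          using t by (simp_all add: pv_def pk_def algebra_simps)
        have X: "\<sigma> j * Re z = 1 - t / 2" unfolding z by (simp add: \<sigma>_def)
        show ?thesis using 2 t(1,2) unfolding X z(2) by simp
      qed
    qed
    obtain i j where k: "k = (i, j)" "0 < i" "j = 1 \<or> j = 2" using v by auto
    obtain i' j' where l: "l = (i', j')" "0 < i'" "j' = 1 \<or> j' = 2" using w by auto
    have s: "Im z = i * (1 - \<sigma> j * Re z)" "0 \<le> \<sigma> j * Re z" "\<sigma> j * Re z \<le> 1"
        "if v = (i, 0) then \<sigma> j * Re z \<le> 1/2 else 1/2 \<le> \<sigma> j * Re z"
      using seg[of i j v] v z k by auto
    have s': "Im z = i' * (1 - \<sigma> j' * Re z)" "0 \<le> \<sigma> j' * Re z" "\<sigma> j' * Re z \<le> 1"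
        "if w = (i', 0) then \<sigma> j' * Re z \<le> 1/2 else 1/2 \<le> \<sigma> j' * Re z"
      using seg[of i' j' w] w z l by auto
    have vv: "v = (i, 0) \<or> v = (0, j)" and ww: "w = (i', 0) \<or> w = (0, j')" using v w k l by auto
    show "v = w \<and> k = l \<or> v = w \<and> z = pv v \<or> k = l \<and> z = pk k"
    \<comment> \<open>On the same side, the two halves of one long segment meet in the midpoint, and
      long segments of different heights meet in their common end \<open>\<sigma> j\<close>.
      Segments on opposite sides can meet only on the imaginary axis.\<close>
    proof (cases "j = j'")
      case True
      have R: "Re z = \<sigma> j * (\<sigma> j * Re z)" by (simp add: \<sigma>_def)
      show ?thesis
      proof (cases "i = i'")
        case True
        show ?thesis
        proof (cases "v = w")
          case False
          then have 1: "\<sigma> j * Re z = 1/2" using s(4) s'(4) vv ww True \<open>j = j'\<close> k l by (auto split: if_splits)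
          have "Re z = \<sigma> j / 2" "Im z = i / 2"
            using R s(1) unfolding 1 by simp_all
          then show ?thesis using True \<open>j = j'\<close> k l by (simp add: pk_def complex_eq_iff)
        qed (use True \<open>j = j'\<close> k l in simp)
      next
        case False
        have "(real i - real i') * (1 - \<sigma> j * Re z) = 0"
          using s(1) s'(1) True by (simp add: algebra_simps)
        then have 1: "\<sigma> j * Re z = 1" using False by simp
        then have "v = (0, j)" "w = (0, j)" using s(4) s'(4) vv ww True by (auto split: if_splits)
        moreover have "Re z = \<sigma> j" "Im z = 0"
          using R s(1) unfolding 1 by simp_all
        ultimately show ?thesis using k by (auto simp: pv_def complex_eq_iff)
      qed
    next
      case False
      then have "\<sigma> j' = - \<sigma> j" using k l by (auto simp: \<sigma>_def)
      then have 0: "\<sigma> j * Re z = 0" "\<sigma> j' * Re z = 0" using s(2) s'(2) by auto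
      then have "i = i'" "Re z = 0" "Im z = i" using s(1) s'(1) by (auto simp: \<sigma>_def split: if_splits)
      moreover have "v = (i, 0)" "w = (i', 0)" using s(4) s'(4) 0 vv ww by (auto split: if_splits)
      ultimately show ?thesis by (simp add: pv_def complex_eq_iff)
    qed
  qed
qed

text \<open>The vertices are \<open>0 = q\<close>, \<open>1 = r\<close>, \<open>2 = p\<close>, \<open>3 = p\<^sup>2\<close>, \<open>4 = q r\<close>, \<open>5 = p r\<close>, \<open>6 = p\<^sup>2 r\<close>,
  \<open>7 = p q\<close>, \<open>8 = p\<^sup>2 q\<close>. All segments of the drawing are axis-parallel, so two of them meet at most in
  an end point as soon as their projections to one axis are disjoint or those to both axes touch.\<close>

lemma planar_three_primes:
  "planar_hypergraph ({0,1,2,3,4,5,6,7,8::nat},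
     {{2,0,1}, {3,0,1}, {2,4}, {3,4}, {0,5}, {0,6}, {1,7}, {1,8}})"
proof -
  define h :: "nat \<Rightarrow> nat set"
    where "h k = [{2,0,1}, {3,0,1}, {2,4}, {3,4}, {0,5}, {0,6}, {1,7}, {1,8}] ! k" for k
  \<comment> \<open>Positions are integer pairs, made complex only by \<open>c\<close>, so that all
    pairs of segments can be compared by evaluation in \<open>check\<close>.\<close>
  define pv :: "nat \<Rightarrow> int \<times> int"
    where "pv v = [(1,0), (0,1), (0,-3), (4,1), (4,-2), (3,0), (1,-2), (-2,1), (0,3)] ! v" for v
  define pk :: "nat \<Rightarrow> int \<times> int"
    where "pk k = [(0,0), (1,1), (4,-3), (4,-1), (2,0), (1,-1), (-1,1), (0,2)] ! k" for k
  define c :: "int \<times> int \<Rightarrow> complex" where "c = (\<lambda>(x, y). Complex x y)"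
  define V where "V = {0,1,2,3,4,5,6,7,8::nat}"
  define K where "K = {0,1,2,3,4,5,6,7::nat}"
  \<comment> \<open>\<open>disj\<close> says that the intervals spanned by \<open>a\<close>,
    \<open>b\<close> and by \<open>a'\<close>, \<open>b'\<close> are disjoint, \<open>touch\<close>
    that they are adjacent with \<open>x\<close> as their only common point.\<close>
  define disj where "disj a b a' b' \<longleftrightarrow> max a b < min a' b' \<or> max a' b' < min a b" for a b a' b' :: int
  define touch where "touch a b a' b' x \<longleftrightarrow> max a b = x \<and> min a' b' = x \<or> max a' b' = x \<and> min a b = x"
    for a b a' b' x :: int
  have check: "\<forall>v\<in>V. \<forall>k\<in>K. v \<in> h k \<longrightarrow> (\<forall>w\<in>V. \<forall>l\<in>K. w \<in> h l \<longrightarrow>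
    v = w \<and> k = l \<or>
    disj (fst (pv v)) (fst (pk k)) (fst (pv w)) (fst (pk l)) \<or>
    disj (snd (pv v)) (snd (pk k)) (snd (pv w)) (snd (pk l)) \<or>
    v = w \<and> touch (fst (pv v)) (fst (pk k)) (fst (pv w)) (fst (pk l)) (fst (pv v)) \<and>
      touch (snd (pv v)) (snd (pk k)) (snd (pv w)) (snd (pk l)) (snd (pv v)) \<or>
    k = l \<and> touch (fst (pv v)) (fst (pk k)) (fst (pv w)) (fst (pk l)) (fst (pk k)) \<and>
      touch (snd (pv v)) (snd (pk k)) (snd (pv w)) (snd (pk l)) (snd (pk k)))"
    unfolding V_def K_def h_def pv_def pk_def disj_def touch_def by code_simp
  have c_inj: "c x = c y \<longleftrightarrow> x = y" for x y by (auto simp: c_def split: prod.splits)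
  have bnd: "real_of_int (min a b) \<le> x \<and> x \<le> real_of_int (max a b)"
    if "0 \<le> t" "t \<le> 1" "x = (1 - t) * a + t * b" for t x :: real and a b :: int
    using convex_bound_le[of a "max a b" b "1 - t" t] convex_bound_le[of "- a" "- min a b" "- b" "1 - t" t] that
    by (simp add: algebra_simps)
  \<comment> \<open>A segment is replaced by its bounding box; for axis-parallel segments nothing is
    lost by this.\<close>
  have box: "real_of_int (min (fst p) (fst q)) \<le> Re z" "Re z \<le> real_of_int (max (fst p) (fst q))"
      "real_of_int (min (snd p) (snd q)) \<le> Im z" "Im z \<le> real_of_int (max (snd p) (snd q))"
    if z: "z \<in> closed_segment (c p) (c q)" for z p q
  proof -
    obtain t where t: "0 \<le> t" "t \<le> 1" "Re z = (1 - t) * Re (c p) + t * Re (c q)"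
        "Im z = (1 - t) * Im (c p) + t * Im (c q)"
      using in_closed_segment_complexD[OF z] by blast
    show "real_of_int (min (fst p) (fst q)) \<le> Re z" "Re z \<le> real_of_int (max (fst p) (fst q))"
      "real_of_int (min (snd p) (snd q)) \<le> Im z" "Im z \<le> real_of_int (max (snd p) (snd q))"
      using bnd[OF t(1,2), of "Re z" "fst p" "fst q"] bnd[OF t(1,2), of "Im z" "snd p" "snd q"] t(3,4)
      by (simp_all add: c_def split_def del: of_int_min of_int_max)
  qed
  have "planar_hypergraph (V, h ` K)"
  proof (rule straight_line_planar_hypergraph[where pv = "c \<circ> pv" and pk = "c \<circ> pk"])
    show "inj_on h K" by (simp add: K_def h_def set_eq_subset)
    show "inj_on (c \<circ> pv) V" "inj_on (c \<circ> pk) K"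
      by (simp_all add: V_def K_def c_inj pv_def pk_def)
    show "(c \<circ> pv) v \<noteq> (c \<circ> pk) k" if "v \<in> V" "k \<in> K" for v k
      using that by (auto simp: V_def K_def c_inj pv_def pk_def)
    show "\<exists>k\<in>K. v \<in> h k" if "v \<in> V" for v
      using that by (auto simp: V_def K_def h_def)
    show "\<exists>v\<in>V. v \<in> h k" if "k \<in> K" for k
      using that by (auto simp: V_def K_def h_def)
    fix v k w l z
    assume v: "v \<in> V" "k \<in> K" "v \<in> h k" and w: "w \<in> V" "l \<in> K" "w \<in> h l"
      and z: "z \<in> closed_segment ((c \<circ> pv) v) ((c \<circ> pk) k)" "z \<in> closed_segment ((c \<circ> pv) w) ((c \<circ> pk) l)"
    have disjD: "\<not> disj a b a' b'"
      if "real_of_int (min a b) \<le> x" "x \<le> max a b" "real_of_int (min a' b') \<le> x" "x \<le> max a' b'"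
      for a b a' b' and x :: real
      using that unfolding disj_def by linarith
    have touchD: "x = y"
      if "real_of_int (min a b) \<le> x" "x \<le> max a b" "real_of_int (min a' b') \<le> x" "x \<le> max a' b'"
        "touch a b a' b' y" for a b a' b' y and x :: real
      using that unfolding touch_def by auto
    have cz: "z = c p" if "Re z = real_of_int (fst p)" "Im z = real_of_int (snd p)" for p
      using that by (simp add: c_def split_def complex_eq_iff)
    note z = z[unfolded comp_apply]
    note x = box(1,2)[OF z(1)] box(1,2)[OF z(2)] and y = box(3,4)[OF z(1)] box(3,4)[OF z(2)]
    from check[rule_format, OF v w] disjD[OF x] disjD[OF y]
    consider "v = w" "k = l"
      | "v = w" "touch (fst (pv v)) (fst (pk k)) (fst (pv w)) (fst (pk l)) (fst (pv v))"
        "touch (snd (pv v)) (snd (pk k)) (snd (pv w)) (snd (pk l)) (snd (pv v))"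
      | "k = l" "touch (fst (pv v)) (fst (pk k)) (fst (pv w)) (fst (pk l)) (fst (pk k))"
        "touch (snd (pv v)) (snd (pk k)) (snd (pv w)) (snd (pk l)) (snd (pk k))"
      by blast
    then show "v = w \<and> k = l \<or> v = w \<and> z = (c \<circ> pv) v \<or> k = l \<and> z = (c \<circ> pk) k"
    proof cases
      case 2
      then show ?thesis using cz[OF touchD[OF x 2(2)] touchD[OF y 2(3)]] by simp
    next
      case 3
      then show ?thesis using cz[OF touchD[OF x 3(2)] touchD[OF y 3(3)]] by simp
    qed simp
  qed
  moreover have "h ` K = {{2,0,1}, {3,0,1}, {2,4}, {3,4}, {0,5}, {0,6}, {1,7}, {1,8}}"
    by (simp add: h_def K_def)
  ultimately show ?thesis by (simp add: V_def)
qed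

section \<open>Hypergraphs of partitions\<close>

text \<open>With divisors for \<open>V\<close> and \<open>prime_factors\<close> for \<open>s\<close>
  this is the hypergraph of the overview. The abstraction keeps apart the label of a vertex and its
  block: different vertices may have equal supports, but then never lie in one hyperedge, supports
  being non-empty.\<close>

definition support_hypergraph :: "'v set \<Rightarrow> ('v \<Rightarrow> 'i set) \<Rightarrow> 'i set \<Rightarrow> 'v hypergraph"
  where "support_hypergraph V s I = (let W = {v \<in> V. s v \<noteq> {} \<and> s v \<subset> I} in
    (W, {D. D \<subseteq> W \<and> pairwise (\<lambda>x y. s x \<inter> s y = {}) D \<and> \<Union>(s ` D) = I}))"

lemma support_vertex_iff [simp]:
  "v \<in> hverts (support_hypergraph V s I) \<longleftrightarrow> v \<in> V \<and> s v \<noteq> {} \<and> s v \<subset> I"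
  by (simp add: support_hypergraph_def Let_def)

lemma support_edge_iff:
  "D \<in> hedges (support_hypergraph V s I) \<longleftrightarrow> D \<subseteq> hverts (support_hypergraph V s I) \<and>
     pairwise (\<lambda>x y. s x \<inter> s y = {}) D \<and> \<Union>(s ` D) = I"
  by (simp add: support_hypergraph_def Let_def)

lemma support_edge_pair:
  assumes "x \<in> V" "y \<in> V" "s x = A" "s y = B" "A \<noteq> {}" "B \<noteq> {}" "A \<inter> B = {}" "A \<union> B = I"
  shows "{x, y} \<in> hedges (support_hypergraph V s I)"
  unfolding support_edge_iff using assms by (auto simp: pairwise_insert)

lemma support_edge_triple:
  assumes "x \<in> V" "y \<in> V" "z \<in> V" "s x = A" "s y = B" "s z = C" "A \<noteq> {}" "B \<noteq> {}" "C \<noteq> {}"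
    "A \<inter> B = {}" "A \<inter> C = {}" "B \<inter> C = {}" "A \<union> B \<union> C = I"
  shows "{x, y, z} \<in> hedges (support_hypergraph V s I)"
proof -
  have "A \<noteq> I" "B \<noteq> I" "C \<noteq> I" using assms(7-13) by blast+
  moreover have "A \<subseteq> I" "B \<subseteq> I" "C \<subseteq> I" using assms(13) by blast+
  ultimately have "{x, y, z} \<subseteq> hverts (support_hypergraph V s I)"
    using assms(1-9) by (simp add: psubset_eq)
  moreover have "pairwise (\<lambda>x y. s x \<inter> s y = {}) {x, y, z}"
    using assms(4-6,10-12) by (auto simp: pairwise_insert)
  moreover have "\<Union>(s ` {x, y, z}) = I" using assms(4-6,13) by auto
  ultimately show ?thesis unfolding support_edge_iff by blast
qed

section \<open>Non-planarity criteria in terms of supports\<close>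

lemma not_planar_by_labels:
  assumes "\<not> planar_hypergraph ({..<length xs}, E)" "distinct xs"
    and "\<And>e. e \<in> E \<Longrightarrow> e \<subseteq> {..<length xs} \<and> (!) xs ` e \<in> hedges X"
    and "set xs \<subseteq> hverts X"
  shows "\<not> planar_hypergraph X"
proof
  assume "planar_hypergraph X"
  then have "planar_hypergraph ({..<length xs}, E)"
  proof (rule planar_hypergraph_embed[where f = "(!) xs"])
    show "inj_on ((!) xs) (hverts ({..<length xs}, E))"
      using assms(2) by (auto simp: inj_on_def nth_eq_iff_index_eq)
    show "(!) xs ` hverts ({..<length xs}, E) \<subseteq> hverts X" using assms(4) by (auto simp: subset_iff)
  qed (use assms(3) in auto)
  with assms(1) show False by simp
qed

lemma not_planar_cubes_support:
  assumes V: "set [x1, x2, x3, y1, y2, y3] \<subseteq> V" and d: "distinct [x1, x2, x3]" "distinct [y1, y2, y3]"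
    and s: "s x1 = A" "s x2 = A" "s x3 = A" "s y1 = B" "s y2 = B" "s y3 = B"
    and AB: "A \<noteq> {}" "B \<noteq> {}" "A \<inter> B = {}" "A \<union> B = I"
  shows "\<not> planar_hypergraph (support_hypergraph V s I)"
proof (rule not_planar_by_labels)
  let ?xs = "[x1, x2, x3, y1, y2, y3]"
  have "{..<length ?xs} = {0,1,2,3,4,5}" by auto
  then show "\<not> planar_hypergraph ({..<length ?xs},
      {{0,3}, {0,4}, {0,5}, {1,3}, {1,4}, {1,5}, {2,3}, {2,4}, {2,5}})"
    using not_planar_two_primes by simp
  have "A \<noteq> B" using AB by auto
  then show "distinct ?xs" using d s by auto
  have "A \<subset> I" "B \<subset> I" using AB by auto
  then show "set ?xs \<subseteq> hverts (support_hypergraph V s I)"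
    using V s AB by simp
  have "{x, y} \<in> hedges (support_hypergraph V s I)" if "x \<in> {x1, x2, x3}" "y \<in> {y1, y2, y3}" for x y
  proof -
    have "x \<in> V" "y \<in> V" "s x = A" "s y = B" using that V s by auto
    then show ?thesis by (rule support_edge_pair) (fact AB)+
  qed
  then show "e \<subseteq> {..<length ?xs} \<and> (!) ?xs ` e \<in> hedges (support_hypergraph V s I)"
    if "e \<in> {{0,3}, {0,4}, {0,5}, {1,3}, {1,4}, {1,5}, {2,3}, {2,4}, {2,5}}" for e
    using that by (elim insertE emptyE) simp_all
qed

text \<open>\<open>A\<close>, \<open>B\<close>, \<open>C\<close> are arbitrary blocks rather than
  single primes, so that \<open>C\<close> can take in all primes beyond the first two.\<close>

lemma not_planar_cube_support:
  assumes V: "set [y, z, t, x1, x2, x3] \<subseteq> V" and d: "distinct [x1, x2, x3]"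
    and s: "s x1 = A" "s x2 = A" "s x3 = A" "s y = B" "s z = C" "s t = B \<union> C"
    and ne: "A \<noteq> {}" "B \<noteq> {}" "C \<noteq> {}" and disj: "A \<inter> B = {}" "A \<inter> C = {}" "B \<inter> C = {}"
    and un: "A \<union> B \<union> C = I"
  shows "\<not> planar_hypergraph (support_hypergraph V s I)"
proof (rule not_planar_by_labels)
  let ?xs = "[y, z, t, x1, x2, x3]"
  have "{..<length ?xs} = {0,1,2,3,4,5}" by auto
  then show "\<not> planar_hypergraph ({..<length ?xs}, {{3,0,1}, {4,0,1}, {5,0,1}, {3,2}, {4,2}, {5,2}})"
    using not_planar_cube by simp
  have "B \<noteq> C" "B \<noteq> B \<union> C" "C \<noteq> B \<union> C" "A \<noteq> B" "A \<noteq> C" "A \<noteq> B \<union> C" using ne disj by blast+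
  then show "distinct ?xs" using d s by auto
  have "A \<subset> I" "B \<subset> I" "C \<subset> I" "B \<union> C \<subset> I" using ne disj un by blast+
  then show "set ?xs \<subseteq> hverts (support_hypergraph V s I)"
    using V s ne by simp
  have "{x, y, z} \<in> hedges (support_hypergraph V s I)" "{x, t} \<in> hedges (support_hypergraph V s I)"
    if x: "x \<in> {x1, x2, x3}" for x
  proof -
    have x: "x \<in> V" "s x = A" "y \<in> V" "z \<in> V" "t \<in> V" using x V s by auto
    show "{x, y, z} \<in> hedges (support_hypergraph V s I)"
      by (rule support_edge_triple) (fact x s ne disj un)+
    have "B \<union> C \<noteq> {}" "A \<inter> (B \<union> C) = {}" "A \<union> (B \<union> C) = I" using ne disj un by blast+
    then show "{x, t} \<in> hedges (support_hypergraph V s I)"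
      using x s(6) ne(1) by (intro support_edge_pair[where A = A and B = "B \<union> C"])
  qed
  then show "e \<subseteq> {..<length ?xs} \<and> (!) ?xs ` e \<in> hedges (support_hypergraph V s I)"
    if "e \<in> {{3,0,1}, {4,0,1}, {5,0,1}, {3,2}, {4,2}, {5,2}}" for e
    using that by (elim insertE emptyE) simp_all
qed

lemma not_planar_two_squares_support:
  assumes V: "set [x1, x2, y1, y2, z, t, u] \<subseteq> V" and d: "x1 \<noteq> x2" "y1 \<noteq> y2"
    and s: "s x1 = A" "s x2 = A" "s y1 = B" "s y2 = B" "s z = C" "s t = A \<union> C" "s u = B \<union> C"
    and ne: "A \<noteq> {}" "B \<noteq> {}" "C \<noteq> {}" and disj: "A \<inter> B = {}" "A \<inter> C = {}" "B \<inter> C = {}"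
    and un: "A \<union> B \<union> C = I"
  shows "\<not> planar_hypergraph (support_hypergraph V s I)"
proof (rule not_planar_by_labels)
  let ?xs = "[x1, x2, y1, y2, z, t, u]"
  have "{..<length ?xs} = {0,1,2,3,4,5,6}" by auto
  then show "\<not> planar_hypergraph ({..<length ?xs},
      {{0,2,4}, {0,3,4}, {1,2,4}, {1,3,4}, {0,6}, {1,6}, {2,5}, {3,5}})"
    using not_planar_two_squares by simp
  obtain a b c where m: "a \<in> A" "b \<in> B" "c \<in> C" using ne by blast
  then have m': "a \<notin> B" "a \<notin> C" "b \<notin> A" "b \<notin> C" "c \<notin> A" "c \<notin> B" using disj by blast+
  \<comment> \<open>Distinctness of the list is read off a fingerprint: the blocks met by the
    support, together with a mark on one of the two vertices over \<open>A\<close> and over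
    \<open>B\<close>.\<close>
  have "distinct (map (\<lambda>x. (a \<in> s x, b \<in> s x, c \<in> s x, x = x1, x = y1)) ?xs)"
    using m m' s d d[symmetric] by simp
  then show "distinct ?xs" by (rule distinct_map[THEN iffD1, THEN conjunct1])
  have "A \<subset> I" "B \<subset> I" "C \<subset> I" "A \<union> C \<subset> I" "B \<union> C \<subset> I" using m m' un by auto
  then show "set ?xs \<subseteq> hverts (support_hypergraph V s I)"
    using V s ne by simp
  have x: "x \<in> V" "s x = A" if "x \<in> {x1, x2}" for x using that V s by auto
  have y: "y \<in> V" "s y = B" if "y \<in> {y1, y2}" for y using that V s by auto
  have ztu: "z \<in> V" "t \<in> V" "u \<in> V" using V by auto
  have sets: "A \<union> C \<noteq> {}" "B \<union> C \<noteq> {}" "A \<inter> (B \<union> C) = {}" "B \<inter> (A \<union> C) = {}"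
    "A \<union> (B \<union> C) = I" "B \<union> (A \<union> C) = I" using ne disj un by blast+
  have "{x, y, z} \<in> hedges (support_hypergraph V s I)" if "x \<in> {x1, x2}" "y \<in> {y1, y2}" for x y
    by (rule support_edge_triple) (fact x[OF that(1)] y[OF that(2)] ztu s ne disj un)+
  moreover have "{x, u} \<in> hedges (support_hypergraph V s I)" if "x \<in> {x1, x2}" for x
    by (rule support_edge_pair) (fact x[OF that] ztu s ne sets)+
  moreover have "{y, t} \<in> hedges (support_hypergraph V s I)" if "y \<in> {y1, y2}" for y
    by (rule support_edge_pair) (fact y[OF that] ztu s ne sets)+
  ultimately show "e \<subseteq> {..<length ?xs} \<and> (!) ?xs ` e \<in> hedges (support_hypergraph V s I)"
    if "e \<in> {{0,2,4}, {0,3,4}, {1,2,4}, {1,3,4}, {0,6}, {1,6}, {2,5}, {3,5}}" for e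
    using that by (elim insertE emptyE) simp_all
qed

text \<open>One vertex \<open>f J\<close> for each union \<open>J\<close> of blocks is enough, so no
  exponent above 1 is involved; in the application \<open>D\<close> collects all primes but
  three.\<close>

lemma not_planar_four_blocks_support:
  assumes V: "\<And>J. J \<subseteq> I \<Longrightarrow> f J \<in> V \<and> s (f J) = J"
    and ne: "A \<noteq> {}" "B \<noteq> {}" "C \<noteq> {}" "D \<noteq> {}"
    and disj: "A \<inter> B = {}" "A \<inter> C = {}" "A \<inter> D = {}" "B \<inter> C = {}" "B \<inter> D = {}" "C \<inter> D = {}"
    and un: "A \<union> B \<union> C \<union> D = I"
  shows "\<not> planar_hypergraph (support_hypergraph V s I)"
proof (rule not_planar_by_labels)
  let ?Js = "[A, B, C, D, A \<union> B, C \<union> D, B \<union> D, A \<union> D, B \<union> C, A \<union> C]"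
  let ?xs = "map f ?Js"
  have "{..<length ?xs} = {0,1,2,3,4,5,6,7,8,9}" by auto
  then show "\<not> planar_hypergraph ({..<length ?xs},
      {{0,1,5}, {2,3,4}, {0,2,6}, {1,2,7}, {0,3,8}, {1,3,9}, {4,5}})"
    using not_planar_four_primes by simp
  obtain a b c d where m: "a \<in> A" "b \<in> B" "c \<in> C" "d \<in> D" using ne by blast
  then have m': "a \<notin> B" "a \<notin> C" "a \<notin> D" "b \<notin> A" "b \<notin> C" "b \<notin> D" "c \<notin> A" "c \<notin> B" "c \<notin> D"
    "d \<notin> A" "d \<notin> B" "d \<notin> C" using disj by blast+
  have sub: "J \<subset> I \<and> J \<noteq> {}" if "J \<in> set ?Js" for J
  proof -
    have "J \<subseteq> A \<union> B \<union> C \<union> D" using that by auto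
    moreover have "\<forall>J \<in> set ?Js. \<not> {a, b, c, d} \<subseteq> J" "\<forall>J \<in> set ?Js. J \<inter> {a, b, c, d} \<noteq> {}"
      using m m' by simp_all
    moreover have "{a, b, c, d} \<subseteq> A \<union> B \<union> C \<union> D" using m by simp
    ultimately show ?thesis unfolding un using that by blast
  qed
  have "distinct (map (\<lambda>J. (a \<in> J, b \<in> J, c \<in> J, d \<in> J)) ?Js)" using m m' by simp
  then have "distinct ?Js" by (rule distinct_map[THEN iffD1, THEN conjunct1])
  moreover have "inj_on f (set ?Js)"
    by (rule inj_onI) (metis V sub psubset_imp_subset)
  ultimately show "distinct ?xs" by (simp only: distinct_map)
  show "set ?xs \<subseteq> hverts (support_hypergraph V s I)"
  proof -
    have "f J \<in> hverts (support_hypergraph V s I)" if "J \<in> set ?Js" for J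
      using sub[OF that] V[of J] by (simp add: psubset_imp_subset)
    then show ?thesis unfolding set_map by blast
  qed
  have pair: "{f J, f K} \<in> hedges (support_hypergraph V s I)"
    if "J \<noteq> {}" "K \<noteq> {}" "J \<inter> K = {}" "J \<union> K = I" for J K
    using that V[of J] V[of K] by (intro support_edge_pair[of _ _ _ _ J K]) auto
  have triple: "{f J, f K, f L} \<in> hedges (support_hypergraph V s I)"
    if "J \<noteq> {}" "K \<noteq> {}" "L \<noteq> {}" "J \<inter> K = {}" "J \<inter> L = {}" "K \<inter> L = {}" "J \<union> K \<union> L = I" for J K L
    using that V[of J] V[of K] V[of L] by (intro support_edge_triple[of _ _ _ _ _ J K L]) auto
  have disj': "B \<inter> A = {}" "C \<inter> A = {}" "D \<inter> A = {}" "C \<inter> B = {}" "D \<inter> B = {}" "D \<inter> C = {}"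
    using disj by blast+
  have "{f A, f B, f (C \<union> D)} \<in> hedges (support_hypergraph V s I)"
    "{f C, f D, f (A \<union> B)} \<in> hedges (support_hypergraph V s I)"
    "{f A, f C, f (B \<union> D)} \<in> hedges (support_hypergraph V s I)"
    "{f B, f C, f (A \<union> D)} \<in> hedges (support_hypergraph V s I)"
    "{f A, f D, f (B \<union> C)} \<in> hedges (support_hypergraph V s I)"
    "{f B, f D, f (A \<union> C)} \<in> hedges (support_hypergraph V s I)"
    "{f (A \<union> B), f (C \<union> D)} \<in> hedges (support_hypergraph V s I)"
    by (rule pair triple; simp add: ne disj disj' un[symmetric] Un_ac Int_Un_distrib Int_Un_distrib2)+
  then show "e \<subseteq> {..<length ?xs} \<and> (!) ?xs ` e \<in> hedges (support_hypergraph V s I)"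
    if "e \<in> {{0,1,5}, {2,3,4}, {0,2,6}, {1,2,7}, {0,3,8}, {1,3,9}, {4,5}}" for e
    using that by (elim insertE emptyE) simp_all
qed

section \<open>Subgroups of cyclic groups\<close>

text \<open>The subgroup is described as the elements killed by \<open>d\<close>, not as the
  multiples of \<open>n div d\<close>: then intersections become gcds directly, and Lagrange's
  theorem puts every subgroup of order \<open>d\<close> into it.\<close>

definition cyclic_subgroup :: "nat \<Rightarrow> nat \<Rightarrow> int set"
  where "cyclic_subgroup n d = {x \<in> {0..<int n}. int n dvd int d * x}"

lemma subgroup_cyclic_subgroup:
  assumes "n > 0"
  shows "subgroup (cyclic_subgroup n d) (integer_mod_group n)"
proof
  show "cyclic_subgroup n d \<subseteq> carrier (integer_mod_group n)"
    using assms by (auto simp: cyclic_subgroup_def carrier_integer_mod_group)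
  have mod: "int n dvd int d * (x mod int n)" if "int n dvd int d * x" for x
    using that by (metis dvd_mod_iff dvd_refl mod_mult_right_eq)
  show "x \<otimes>\<^bsub>integer_mod_group n\<^esub> y \<in> cyclic_subgroup n d"
    if "x \<in> cyclic_subgroup n d" "y \<in> cyclic_subgroup n d" for x y
    using that assms mod[of "x + y"] by (simp add: cyclic_subgroup_def distrib_left)
  show "\<one>\<^bsub>integer_mod_group n\<^esub> \<in> cyclic_subgroup n d"
    using assms by (simp add: cyclic_subgroup_def)
  show "inv\<^bsub>integer_mod_group n\<^esub> x \<in> cyclic_subgroup n d" if "x \<in> cyclic_subgroup n d" for x
  proof -
    have "x \<in> carrier (integer_mod_group n)"
      using that assms by (simp add: cyclic_subgroup_def carrier_integer_mod_group)
    then show ?thesis using that assms mod[of "-x"] by (simp add: cyclic_subgroup_def)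
  qed
qed

lemma card_cyclic_subgroup:
  assumes "n > 0" "d dvd n"
  shows "card (cyclic_subgroup n d) = d"
proof -
  obtain k where k: "n = d * k" using assms(2) by blast
  have pos: "d > 0" "k > 0" using assms k by auto
  have "cyclic_subgroup n d = (\<lambda>i. int (k * i)) ` {..<d}"
  proof (intro equalityI subsetI)
    fix x assume "x \<in> cyclic_subgroup n d"
    then have x: "0 \<le> x" "x < int n" "int d * int k dvd int d * x"
      by (auto simp: cyclic_subgroup_def k)
    then have "int k dvd x" using pos by simp
    then obtain y where y: "x = int k * y" by blast
    have "0 \<le> y" "y < int d" using x pos by (auto simp: y k zero_le_mult_iff mult.commute)
    then show "x \<in> (\<lambda>i. int (k * i)) ` {..<d}"
      using y by (intro image_eqI[of _ _ "nat y"]) auto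
  next
    fix x assume "x \<in> (\<lambda>i. int (k * i)) ` {..<d}"
    then obtain i where "x = int (k * i)" "i < d" by auto
    moreover have "k * i < d * k" using \<open>i < d\<close> pos by (simp add: mult.commute)
    moreover have "int d * int k dvd int d * (int k * int i)" by (simp add: mult.assoc[symmetric])
    ultimately show "x \<in> cyclic_subgroup n d"
      by (simp add: cyclic_subgroup_def k flip: of_nat_mult)
  qed
  moreover have "inj_on (\<lambda>i. int (k * i)) {..<d}" using pos by (simp add: inj_on_def)
  ultimately show ?thesis by (simp add: card_image)
qed

text \<open>The order of \<open>H\<close> divides \<open>n\<close> and kills every element of
  \<open>H\<close>, so \<open>H\<close> is contained in a cyclic subgroup of the same
  cardinality.\<close>

lemma subgroup_integer_mod_group:
  assumes "n > 0" "subgroup H (integer_mod_group n)"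
  shows "card H dvd n" "H = cyclic_subgroup n (card H)"
proof -
  let ?G = "integer_mod_group n"
  interpret G: group ?G by simp
  have carr: "carrier ?G = {0..<int n}" using assms(1) by (simp add: carrier_integer_mod_group)
  then have fin: "finite (carrier ?G)" by simp
  have HG: "H \<subseteq> carrier ?G" using assms(2) by (rule subgroup.subset)
  have "card (rcosets\<^bsub>?G\<^esub> H) * card H = Coset.order ?G"
    by (rule G.lagrange[OF assms(2)])
  then show d: "card H dvd n" using carr by (simp add: Coset.order_def) (metis dvd_triv_right)
  interpret H: group "?G\<lparr>carrier := H\<rparr>"
    using assms(2) by (simp add: G.subgroup_imp_group)
  have "int n dvd int (card H) * x" if "x \<in> H" for x
  proof -
    have "x [^]\<^bsub>?G\<lparr>carrier := H\<rparr>\<^esub> Coset.order (?G\<lparr>carrier := H\<rparr>) = \<one>\<^bsub>?G\<lparr>carrier := H\<rparr>\<^esub>"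
      using that by (intro H.pow_order_eq_1) simp
    then have "x [^]\<^bsub>?G\<^esub> card H = \<one>\<^bsub>?G\<^esub>"
      by (simp add: Coset.order_def flip: G.nat_pow_consistent)
    then show ?thesis by (simp add: dvd_eq_mod_eq_0)
  qed
  then have "H \<subseteq> cyclic_subgroup n (card H)" using HG carr by (auto simp: cyclic_subgroup_def)
  then show "H = cyclic_subgroup n (card H)"
  proof (rule card_subset_eq[rotated])
    show "finite (cyclic_subgroup n (card H))"
      by (rule finite_subset[of _ "{0..<int n}"]) (auto simp: cyclic_subgroup_def)
    show "card H = card (cyclic_subgroup n (card H))"
      by (simp add: card_cyclic_subgroup[OF assms(1) d])
  qed
qed

lemma cyclic_subgroup_eq_iff:
  assumes "n > 0" "d dvd n" "e dvd n"
  shows "cyclic_subgroup n d = cyclic_subgroup n e \<longleftrightarrow> d = e"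
  using card_cyclic_subgroup assms by metis

lemma cyclic_subgroup_Int:
  "cyclic_subgroup n d \<inter> cyclic_subgroup n e = cyclic_subgroup n (gcd d e)"
proof -
  have "int n dvd int (gcd d e) * x \<longleftrightarrow> int n dvd int d * x \<and> int n dvd int e * x" if "0 \<le> x" for x
  proof -
    have "gcd (int d * x) (int e * x) = int (gcd d e) * x"
      using that by (simp add: gcd_mult_right gcd.commute)
    then show ?thesis by (metis gcd_greatest_iff)
  qed
  then show ?thesis by (auto simp: cyclic_subgroup_def)
qed

lemma cyclic_subgroup_1: "n > 0 \<Longrightarrow> cyclic_subgroup n 1 = {0}"
proof -
  assume "n > 0"
  then have "cyclic_subgroup n 1 \<subseteq> {0}" "0 \<in> cyclic_subgroup n 1"
    by (auto simp: cyclic_subgroup_def dest: zdvd_imp_le)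
  then show ?thesis by blast
qed

lemma coprime_iff_prime_factors_disjoint:
  fixes d e :: nat
  assumes "d \<noteq> 0" "e \<noteq> 0"
  shows "coprime d e \<longleftrightarrow> prime_factors d \<inter> prime_factors e = {}"
proof
  assume "coprime d e"
  then show "prime_factors d \<inter> prime_factors e = {}"
    by (auto simp: in_prime_factors_iff) (metis coprime_common_divisor not_prime_unit)
next
  assume disj: "prime_factors d \<inter> prime_factors e = {}"
  show "coprime d e"
  proof (rule ccontr)
    assume "\<not> coprime d e"
    then obtain p where "prime p" "p dvd gcd d e" using prime_factor_nat coprime_iff_gcd_eq_1 by metis
    then have "p \<in> prime_factors d \<inter> prime_factors e" using assms by (auto simp: in_prime_factors_iff)
    with disj show False by blast
  qed
qed

text \<open>The map \<open>cyclic_subgroup n\<close> from divisors to subgroups is an isomorphism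
  between the two hypergraphs. What has to be compared is maximality on the side of the subgroups
  with covering all primes on the side of the divisors.\<close>

lemma planar_intersection_hypergraph_integer_mod_group:
  fixes n :: nat
  defines "X \<equiv> support_hypergraph {d. d dvd n} prime_factors (prime_factors n)"
  assumes "n > 0" "card (prime_factors n) \<ge> 2"
  shows "planar_hypergraph (intersection_hypergraph (integer_mod_group n)) \<longleftrightarrow> planar_hypergraph X"
proof -
  let ?G = "integer_mod_group n" and ?P = "prime_factors n" and ?f = "cyclic_subgroup n"
  have one: "{\<one>\<^bsub>?G\<^esub>} = {0}" by simp
  have W: "d \<in> hverts X \<longleftrightarrow> d dvd n \<and> prime_factors d \<noteq> {} \<and> prime_factors d \<subset> ?P" for d
    by (simp add: X_def)
  have WD: "d dvd n" "prime_factors d \<noteq> {}" "prime_factors d \<subset> ?P" if "d \<in> hverts X" for d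
    using that W by simp_all
  have nz: "d \<noteq> 0" if "d dvd n" for d using that assms(2) by auto
  have sub: "prime_factors d \<subseteq> ?P" if "d dvd n" for d
    using that assms(2) by (simp add: dvd_prime_factors)
  have inj: "inj_on ?f {d. d dvd n}"
    by (rule inj_onI) (simp add: cyclic_subgroup_eq_iff[OF assms(2)])
  have injW: "inj_on ?f (hverts X)" by (rule inj_on_subset[OF inj]) (auto simp: W)
  have carr: "carrier ?G = ?f n"
    using assms(2) by (auto simp: carrier_integer_mod_group cyclic_subgroup_def)
  have one_f: "{0} = ?f 1" using cyclic_subgroup_1[OF assms(2)] by simp
  have Int: "?f d \<inter> ?f e = {0} \<longleftrightarrow> prime_factors d \<inter> prime_factors e = {}"
    if "d dvd n" "e dvd n" for d e
  proof -
    have "gcd d e dvd n" using that(1) dvd_trans gcd_dvd1 by blast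
    then have "?f d \<inter> ?f e = {0} \<longleftrightarrow> gcd d e = 1"
      unfolding cyclic_subgroup_Int one_f by (simp add: cyclic_subgroup_eq_iff[OF assms(2)])
    then show ?thesis
      using coprime_iff_prime_factors_disjoint[OF nz[OF that(1)] nz[OF that(2)]]
      by (simp add: coprime_iff_gcd_eq_1)
  qed
  have ntp: "nontrivial_proper_subgroups ?G = ?f ` {d. d dvd n \<and> d \<noteq> 1 \<and> d \<noteq> n}"
  proof (intro equalityI subsetI)
    fix H assume "H \<in> nontrivial_proper_subgroups ?G"
    then have "subgroup H ?G" "H \<noteq> {0}" "H \<noteq> carrier ?G"
      by (simp_all add: nontrivial_proper_subgroups_def)
    moreover from this(1) have "card H dvd n" "H = ?f (card H)"
      by (rule subgroup_integer_mod_group[OF assms(2)])+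
    ultimately have "card H \<noteq> 1" "card H \<noteq> n" using one_f carr by metis+
    then show "H \<in> ?f ` {d. d dvd n \<and> d \<noteq> 1 \<and> d \<noteq> n}"
      using \<open>card H dvd n\<close> \<open>H = ?f (card H)\<close> by blast
  next
    fix H assume "H \<in> ?f ` {d. d dvd n \<and> d \<noteq> 1 \<and> d \<noteq> n}"
    then obtain d where d: "H = ?f d" "d dvd n" "d \<noteq> 1" "d \<noteq> n" by blast
    then have "H \<noteq> {0}" "H \<noteq> carrier ?G"
      unfolding one_f carr using cyclic_subgroup_eq_iff[OF assms(2)] by auto
    then show "H \<in> nontrivial_proper_subgroups ?G"
      using d subgroup_cyclic_subgroup[OF assms(2)] by (simp add: nontrivial_proper_subgroups_def)
  qed
  \<comment> \<open>Here the second prime factor of \<open>n\<close> enters: it makes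
    \<open>{p}\<close> a proper subset of the prime factors.\<close>
  have prime_vertex: "p dvd n \<and> p \<noteq> 1 \<and> p \<noteq> n \<and> prime_factors p = {p} \<and> p \<in> hverts X"
    if "p \<in> ?P" for p
  proof -
    have p: "prime p" "p dvd n" using that by auto
    note p = p prime_prime_factors[OF p(1)]
    have "{p} \<noteq> ?P"
    proof
      assume eq: "{p} = ?P"
      have "card ?P = 1" unfolding eq[symmetric] by simp
      then show False using assms(3) by simp
    qed
    then have "p \<noteq> n" "{p} \<subset> ?P" using p(3) that by auto
    moreover have "p \<noteq> 1" using p(1) by auto
    ultimately show ?thesis using p(2,3) by (simp add: W)
  qed
  have verts: "ih_verts ?G = ?f ` hverts X"
  proof (intro equalityI subsetI)
    fix H assume "H \<in> ih_verts ?G"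
    then obtain d e where d: "H = ?f d" "d dvd n" "d \<noteq> 1" "e dvd n" "e \<noteq> 1" "?f d \<inter> ?f e = {0}"
      unfolding ih_verts_def ntp one by blast
    have ne: "prime_factors x \<noteq> {}" if "x dvd n" "x \<noteq> 1" for x
      using that nz[of x] by (simp add: prime_factorization_empty_iff)
    have "prime_factors d \<inter> prime_factors e = {}" using Int[OF d(2,4)] d(6) by simp
    then have "prime_factors d \<noteq> ?P" using ne[OF d(4,5)] sub[OF d(4)] by blast
    then have "d \<in> hverts X" unfolding W using ne[OF d(2,3)] sub[OF d(2)] d(2) by blast
    then show "H \<in> ?f ` hverts X" using d(1) by blast
  next
    fix H assume "H \<in> ?f ` hverts X"
    then obtain d where "H = ?f d" "d \<in> hverts X" by blast
    note d = this(1) WD[OF this(2)]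
    then obtain p where "p \<in> ?P" "p \<notin> prime_factors d" by blast
    note p = prime_vertex[OF this(1)]
    have "prime_factors d \<inter> prime_factors p = {}" using p \<open>p \<notin> prime_factors d\<close> by simp
    then have "?f d \<inter> ?f p = {0}" using Int[OF d(2), of p] p by simp
    moreover have "d \<noteq> 1" "d \<noteq> n" using d(3,4) by auto
    moreover have "?f x \<in> nontrivial_proper_subgroups ?G" if "x dvd n" "x \<noteq> 1" "x \<noteq> n" for x
      using that unfolding ntp by blast
    ultimately have "?f d \<in> nontrivial_proper_subgroups ?G" "?f p \<in> nontrivial_proper_subgroups ?G"
      "?f d \<inter> ?f p = {0}" using d(2) p by simp_all
    then show "H \<in> ih_verts ?G" unfolding ih_verts_def one d(1) by blast
  qed
  have pw: "pairwise_trivial ?G (?f ` D) \<longleftrightarrow> pairwise (\<lambda>x y. prime_factors x \<inter> prime_factors y = {}) D"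
    if "D \<subseteq> hverts X" for D
  proof -
    have "?f x \<inter> ?f y = {0} \<longleftrightarrow> prime_factors x \<inter> prime_factors y = {}" "?f x = ?f y \<longleftrightarrow> x = y"
      if "x \<in> D" "y \<in> D" for x y
    proof -
      have "x dvd n" "y dvd n" using that \<open>D \<subseteq> hverts X\<close> by (auto intro: WD(1))
      then show "?f x \<inter> ?f y = {0} \<longleftrightarrow> prime_factors x \<inter> prime_factors y = {}" "?f x = ?f y \<longleftrightarrow> x = y"
        using Int cyclic_subgroup_eq_iff[OF assms(2)] by simp_all
    qed
    then show ?thesis unfolding pairwise_trivial_def pairwise_def one by simp
  qed
  have edge: "?f ` D \<in> hedges (intersection_hypergraph ?G) \<longleftrightarrow> D \<in> hedges X" if D: "D \<subseteq> hverts X" for D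
  proof
    assume "?f ` D \<in> hedges (intersection_hypergraph ?G)"
    then have pD: "pairwise (\<lambda>x y. prime_factors x \<inter> prime_factors y = {}) D"
      and max: "\<And>E'. E' \<subseteq> ?f ` hverts X \<Longrightarrow> ?f ` D \<subset> E' \<Longrightarrow> \<not> pairwise_trivial ?G E'"
      using pw[OF D] by (auto simp: intersection_hypergraph_def verts)
    \<comment> \<open>A prime missing from the union could itself be added to \<open>D\<close>,
      against maximality.\<close>
    have "?P \<subseteq> \<Union>(prime_factors ` D)"
    proof
      fix p assume "p \<in> ?P"
      note p = prime_vertex[OF this]
      show "p \<in> \<Union>(prime_factors ` D)"
      proof (rule ccontr)
        assume np: "p \<notin> \<Union>(prime_factors ` D)"
        have D': "insert p D \<subseteq> hverts X" using p D by blast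
        have "pairwise (\<lambda>x y. prime_factors x \<inter> prime_factors y = {}) (insert p D)"
          using pD np p by (auto simp: pairwise_insert)
        then have "pairwise_trivial ?G (?f ` insert p D)" using pw[OF D'] by blast
        moreover have "p \<notin> D" using np p by blast
        then have "?f p \<notin> ?f ` D" using inj_on_image_mem_iff[OF injW _ D] p by blast
        then have "?f ` D \<subset> ?f ` insert p D" by blast
        ultimately show False using max D' by (meson image_mono)
      qed
    qed
    moreover have "\<Union>(prime_factors ` D) \<subseteq> ?P" using D WD(3) by blast
    ultimately show "D \<in> hedges X"
      using D pD unfolding X_def support_edge_iff by blast
  next
    assume "D \<in> hedges X"
    then have pD: "pairwise (\<lambda>x y. prime_factors x \<inter> prime_factors y = {}) D"
      and un: "\<Union>(prime_factors ` D) = ?P" unfolding X_def support_edge_iff by blast+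
    \<comment> \<open>Any further vertex has a prime factor, which some member of \<open>D\<close>
      already contains.\<close>
    have "\<not> pairwise_trivial ?G E'" if E': "E' \<subseteq> ?f ` hverts X" "?f ` D \<subset> E'" for E'
    proof
      assume tr: "pairwise_trivial ?G E'"
      obtain H where H: "H \<in> E'" "H \<notin> ?f ` D" using E'(2) by blast
      then obtain e where "e \<in> hverts X" "H = ?f e" using E'(1) by blast
      note e = this(1) H[unfolded this(2)]
      obtain q where "q \<in> prime_factors e" "q \<in> ?P" using WD(2,3)[OF e(1)] by blast
      then obtain d where d: "d \<in> D" "q \<in> prime_factors d" using un by blast
      have "?f d \<inter> ?f e = {0}"
      proof -
        have "?f d \<in> ?f ` D" using d(1) by (rule imageI)
        then have "?f d \<in> E'" "?f d \<noteq> ?f e" using E'(2) e(3) by (auto simp del: image_eqI)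
        then show ?thesis
          using tr e(2) unfolding pairwise_trivial_def one by (meson pairwiseD)
      qed
      moreover have "d dvd n" "e dvd n" using d(1) e(1) D by (auto intro: WD(1))
      ultimately have "prime_factors d \<inter> prime_factors e = {}" using Int by simp
      then show False using d(2) \<open>q \<in> prime_factors e\<close> by blast
    qed
    then show "?f ` D \<in> hedges (intersection_hypergraph ?G)"
      using pD pw[OF D] D by (auto simp: intersection_hypergraph_def verts)
  qed
  have hv: "hverts (intersection_hypergraph ?G) = ?f ` hverts X"
    by (simp add: intersection_hypergraph_def verts)
  show ?thesis
  proof
    assume "planar_hypergraph (intersection_hypergraph ?G)"
    then show "planar_hypergraph X"
    proof (rule planar_hypergraph_embed[where f = ?f])
      show "e \<subseteq> hverts X \<and> ?f ` e \<in> hedges (intersection_hypergraph ?G)" if "e \<in> hedges X" for e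
        using that edge[of e] unfolding X_def support_edge_iff by blast
    qed (use injW hv in simp_all)
  next
    assume "planar_hypergraph X"
    then show "planar_hypergraph (intersection_hypergraph ?G)"
    proof (rule planar_hypergraph_embed[where f = "the_inv_into (hverts X) ?f"])
      show "inj_on (the_inv_into (hverts X) ?f) (hverts (intersection_hypergraph ?G))"
        unfolding hv by (rule inj_on_the_inv_into[OF injW])
      show "the_inv_into (hverts X) ?f ` hverts (intersection_hypergraph ?G) \<subseteq> hverts X"
        unfolding hv by (simp add: the_inv_into_onto[OF injW])
      fix E assume E: "E \<in> hedges (intersection_hypergraph ?G)"
      then have sub: "E \<subseteq> ?f ` hverts X" by (simp add: intersection_hypergraph_def verts)
      then obtain D where D: "D \<subseteq> hverts X" "E = ?f ` D" by (meson subset_imageE)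
      have "the_inv_into (hverts X) ?f ` E = D"
        unfolding D(2) image_image using D(1) the_inv_into_f_f[OF injW] by (force simp: subset_iff)
      moreover have "D \<in> hedges X" using edge[OF D(1)] E D(2) by simp
      ultimately show "E \<subseteq> hverts (intersection_hypergraph ?G) \<and>
          the_inv_into (hverts X) ?f ` E \<in> hedges X"
        using sub hv by simp
    qed
  qed
qed

section \<open>Divisors\<close>

abbreviation divisor_hypergraph :: "nat \<Rightarrow> nat hypergraph"
  where "divisor_hypergraph n \<equiv> support_hypergraph {d. d dvd n} prime_factors (prime_factors n)"

text \<open>Squarefree divisors realise every set of prime factors, in particular the merged
  blocks.\<close>

lemma prod_primes:
  fixes n :: nat
  assumes "n > 0" "J \<subseteq> prime_factors n"
  shows "\<Prod>J dvd n" "prime_factors (\<Prod>J) = J"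
proof -
  have fin: "finite J" using assms(2) finite_subset by blast
  have "\<Prod>J dvd (\<Prod>p\<in>J. p ^ multiplicity p n)"
    using assms by (intro prod_dvd_prod dvd_power) (auto simp: prime_factors_multiplicity)
  also have "\<dots> dvd (\<Prod>p\<in>prime_factors n. p ^ multiplicity p n)"
    using assms by (intro prod_dvd_prod_subset) auto
  also have "\<dots> = n" using assms(1) by (simp add: prime_factorization_nat[symmetric])
  finally show "\<Prod>J dvd n" .
  have "prime_factors (\<Prod>J) = \<Union>((prime_factors \<circ> (\<lambda>p. p)) ` J)"
    using assms fin by (intro prime_factors_prod) (auto simp: subset_iff)
  also have "\<dots> = (\<Union>p\<in>J. {p})"
  proof (rule SUP_cong[OF refl])
    fix p assume "p \<in> J"
    then have "prime p" using assms(2) by auto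
    then show "(prime_factors \<circ> (\<lambda>p. p)) p = {p}" by (simp only: comp_apply prime_prime_factors)
  qed
  finally show "prime_factors (\<Prod>J) = J" by simp
qed

lemma prime_factors_prime_power:
  assumes "prime (p::nat)" "k > 0"
  shows "prime_factors (p ^ k) = {p}"
  using assms by (simp add: prime_factorization_prime_power)

lemma distinct_powers:
  assumes "prime (p::nat)"
  shows "distinct [p, p^2, p^3]"
proof -
  have "inj_on ((^) p) {1, 2, 3}"
    using prime_gt_1_nat[OF assms] by (intro inj_onI) (simp only: power_inject_exp)
  then have "distinct (map ((^) p) [1, 2, 3])" by (simp only: distinct_map list.set) simp
  then show ?thesis by simp
qed

section \<open>Obstructions in the divisor hypergraph\<close>

lemma not_planar_cubes_divisors:
  assumes "n > 0" "prime_factors n = {p, q}" "p \<noteq> q" "p ^ 3 dvd n" "q ^ 3 dvd n"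
  shows "\<not> planar_hypergraph (divisor_hypergraph n)"
proof (rule not_planar_cubes_support)
  have p: "prime p" "prime q" using assms(2) by (metis in_prime_factors_imp_prime insertI1 insertI2)+
  have "x ^ k dvd n" if "x ^ 3 dvd n" "k \<le> 3" for x k
    by (rule dvd_trans[OF le_imp_power_dvd[OF that(2)] that(1)])
  from this[OF assms(4), of 1] this[OF assms(4), of 2] this[OF assms(5), of 1] this[OF assms(5), of 2] assms(4,5)
  show "set [p, p^2, p^3, q, q^2, q^3] \<subseteq> {d. d dvd n}" by simp
  show "distinct [p, p^2, p^3]" "distinct [q, q^2, q^3]" using distinct_powers p by blast+
  show "prime_factors p = {p}" "prime_factors (p^2) = {p}" "prime_factors (p^3) = {p}"
    "prime_factors q = {q}" "prime_factors (q^2) = {q}" "prime_factors (q^3) = {q}"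
    using p by (simp_all add: prime_factors_prime_power prime_prime_factors)
qed (use assms in auto)

lemma not_planar_cube_divisors:
  assumes "n > 0" "card (prime_factors n) \<ge> 3" "prime p" "p ^ 3 dvd n"
  shows "\<not> planar_hypergraph (divisor_hypergraph n)"
proof -
  let ?P = "prime_factors n"
  have pow: "p ^ k dvd n" if "k \<le> 3" for k
    by (rule dvd_trans[OF le_imp_power_dvd[OF that] assms(4)])
  have p: "p \<in> ?P" using pow[of 1] assms by (simp add: in_prime_factors_iff)
  have c: "card (?P - {p}) \<ge> 2" using assms(2) p by simp
  then have "?P - {p} \<noteq> {}" by (metis card.empty not_numeral_le_zero)
  then obtain q where q: "q \<in> ?P - {p}" by blast
  have "card (?P - {p} - {q}) \<ge> 1" using c q by (simp only: card_Diff_singleton)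
  then have C: "?P - {p} - {q} \<noteq> {}" by (metis card.empty not_one_le_zero)
  \<comment> \<open>All primes other than \<open>p\<close> and \<open>q\<close> form the third
    block.\<close>
  let ?C = "?P - {p} - {q}"
  have sub: "{q} \<subseteq> ?P" "?C \<subseteq> ?P" "{q} \<union> ?C \<subseteq> ?P" using q by auto
  note prod = prod_primes[OF assms(1) sub(1)] prod_primes[OF assms(1) sub(2)] prod_primes[OF assms(1) sub(3)]
  show ?thesis
  proof (rule not_planar_cube_support)
    show "set [\<Prod>{q}, \<Prod>?C, \<Prod>({q} \<union> ?C), p, p^2, p^3] \<subseteq> {d. d dvd n}"
      using prod(1,3,5) pow[of 1] pow[of 2] pow[of 3] by (simp only: list.set) simp
    show "distinct [p, p^2, p^3]" using distinct_powers assms(3) by blast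
    show "prime_factors p = {p}" "prime_factors (p^2) = {p}" "prime_factors (p^3) = {p}"
      using assms(3) by (simp_all add: prime_factors_prime_power prime_prime_factors)
    show "{p} \<union> {q} \<union> ?C = ?P" using p q by blast
  qed (use prod q C in \<open>blast+\<close>)
qed

lemma not_planar_two_squares_divisors:
  assumes "n > 0" "card (prime_factors n) \<ge> 3" "prime p" "prime q" "p \<noteq> q" "p\<^sup>2 dvd n" "q\<^sup>2 dvd n"
  shows "\<not> planar_hypergraph (divisor_hypergraph n)"
proof -
  let ?P = "prime_factors n" and ?C = "prime_factors n - {p} - {q}"
  have dv: "p dvd n" "q dvd n" using assms(6,7) by (auto simp: power2_eq_square elim: dvd_mult_left)
  have p: "p \<in> ?P" "q \<in> ?P" using dv assms by (auto simp: in_prime_factors_iff)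
  have "card ?C \<ge> 1" using assms(2,5) p by simp
  then have C: "?C \<noteq> {}" by (metis card.empty not_one_le_zero)
  have sub: "?C \<subseteq> ?P" "{p} \<union> ?C \<subseteq> ?P" "{q} \<union> ?C \<subseteq> ?P" using p by auto
  note prod = prod_primes[OF assms(1) sub(1)] prod_primes[OF assms(1) sub(2)] prod_primes[OF assms(1) sub(3)]
  show ?thesis
  proof (rule not_planar_two_squares_support)
    show "set [p, p\<^sup>2, q, q\<^sup>2, \<Prod>?C, \<Prod>({p} \<union> ?C), \<Prod>({q} \<union> ?C)] \<subseteq> {d. d dvd n}"
      using prod(1,3,5) dv assms(6,7) by (simp only: list.set) simp
    show "p \<noteq> p\<^sup>2" "q \<noteq> q\<^sup>2" using distinct_powers[OF assms(3)] distinct_powers[OF assms(4)] by auto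
    show "prime_factors p = {p}" "prime_factors (p^2) = {p}" "prime_factors q = {q}" "prime_factors (q^2) = {q}"
      using assms(3,4) by (simp_all add: prime_factors_prime_power prime_prime_factors)
    show "{p} \<union> {q} \<union> ?C = ?P" using p by blast
  qed (use prod assms(5) C in \<open>blast+\<close>)
qed

lemma not_planar_four_primes_divisors:
  assumes "n > 0" "card (prime_factors n) \<ge> 4"
  shows "\<not> planar_hypergraph (divisor_hypergraph n)"
proof -
  let ?P = "prime_factors n"
  obtain T where T: "T \<subseteq> ?P" "card T = 3"
    using obtain_subset_with_card_n[of 3 ?P] assms(2) by auto
  then obtain p q r where pqr: "T = {p, q, r}" "p \<noteq> q" "q \<noteq> r" "p \<noteq> r" by (metis card_3_iff)
  have "card (?P - T) \<ge> 1" using T assms(2) by (simp add: card_Diff_subset finite_subset)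
  then have "?P - T \<noteq> {}" by (metis card.empty not_one_le_zero)
  then show ?thesis
    using T pqr prod_primes[OF assms(1)]
    by (intro not_planar_four_blocks_support[where f = "\<Prod>" and A = "{p}" and B = "{q}" and C = "{r}" and D = "?P - T"]) auto
qed

section \<open>Planarity of the divisor hypergraphs in the list\<close>

lemma planar_hypergraph_cover:
  assumes "planar_hypergraph X" "inj_on f (hverts X)" "\<And>e. e \<in> hedges X \<Longrightarrow> e \<subseteq> hverts X"
    and vert: "\<And>v. v \<in> hverts Y \<Longrightarrow> v \<in> f ` hverts X"
    and edge: "\<And>D. D \<in> hedges Y \<Longrightarrow> D \<subseteq> hverts Y \<and> D \<in> (`) f ` hedges X"
  shows "planar_hypergraph Y"
proof (rule planar_hypergraph_embed[OF assms(1), where f = "the_inv_into (hverts X) f"])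
  \<comment> \<open>Only the part of \<open>X\<close> that occurs in \<open>Y\<close> is kept, so
    one fixed drawing serves all exponents that it has room for.\<close>
  let ?g = "the_inv_into (hverts X) f"
  have sub: "hverts Y \<subseteq> f ` hverts X" using vert by blast
  show "inj_on ?g (hverts Y)"
    by (rule inj_on_subset[OF inj_on_the_inv_into[OF assms(2)] sub])
  show "?g ` hverts Y \<subseteq> hverts X"
    using image_mono[OF sub, of ?g] by (simp add: the_inv_into_onto[OF assms(2)])
  fix D assume D: "D \<in> hedges Y"
  then obtain e where e: "e \<in> hedges X" "D = f ` e" using edge by blast
  have "?g (f x) = x" if "x \<in> e" for x
    using that assms(3)[OF e(1)] by (auto intro: the_inv_into_f_f[OF assms(2)])
  then have "?g ` D = e" unfolding e(2) image_image by simp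
  then show "D \<subseteq> hverts Y \<and> ?g ` D \<in> hedges X" using edge[OF D] e(1) by simp
qed

text \<open>A further element of \<open>D\<close> would have a non-empty support inside
  \<open>I\<close>, where \<open>E\<close> leaves no room. It thus suffices to find enough members
  of a hyperedge to know all of it.\<close>

lemma support_edge_eq:
  assumes "D \<in> hedges (support_hypergraph V s I)" "E \<subseteq> D" "\<Union>(s ` E) = I"
  shows "D = E"
proof (rule ccontr)
  assume "D \<noteq> E"
  then obtain x where x: "x \<in> D" "x \<notin> E" using assms(2) by blast
  have D: "D \<subseteq> hverts (support_hypergraph V s I)" "pairwise (\<lambda>x y. s x \<inter> s y = {}) D"
    using assms(1) unfolding support_edge_iff by simp_all
  then have "x \<in> hverts (support_hypergraph V s I)" using x by blast
  then have "s x \<noteq> {}" "s x \<subseteq> I" by (simp_all add: psubset_eq)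
  then obtain i where i: "i \<in> s x" "i \<in> I" by blast
  then obtain y where y: "y \<in> E" "i \<in> s y" using assms(3) by blast
  then have "y \<in> D" "x \<noteq> y" using x assms(2) by blast+
  then have "s x \<inter> s y = {}" by (rule pairwiseD[OF D(2) x(1)])
  then show False using i y by blast
qed

lemma prime_factors_prime_power_times:
  fixes p m :: nat
  assumes "prime p" "m > 0"
  shows "prime_factors (p ^ i * m) = (if i = 0 then {} else {p}) \<union> prime_factors m"
proof -
  have "p ^ i \<noteq> 0" using assms(1) by auto
  then show ?thesis
    using assms by (cases "i = 0") (simp_all add: prime_factors_product prime_factors_prime_power)
qed

text \<open>A vertex misses one of the primes, so it is a pure power. At most two powers of
  \<open>q\<close> occur, matching the two fixed points of the drawing, which has room for all
  powers of \<open>p\<close>. A hyperedge takes one power of each.\<close>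

lemma planar_two_prime_divisors:
  fixes p q :: nat
  assumes p: "prime p" "prime q" "p \<noteq> q" and ab: "a > 0" "b > 0" "b \<le> 2"
  shows "planar_hypergraph (divisor_hypergraph (p ^ a * q ^ b))"
proof -
  let ?n = "p ^ a * q ^ b" and ?f = "\<lambda>(i, j). p ^ i * q ^ j"
  let ?Y = "divisor_hypergraph ?n"
    and ?H = "({(i, 0) |i. 0 < i} \<union> {(0, 1), (0, 2)},
      (\<lambda>(i, j). {(i, 0), (0, j)}) ` ({i::nat. 0 < i} \<times> {1, 2::nat}))"
  have p1: "p > 1" "q > 1" using p prime_gt_1_nat by auto
  have s: "prime_factors (p ^ i * q ^ j) = (if i = 0 then {} else {p}) \<union> (if j = 0 then {} else {q})" for i j
    using p p1 by (simp add: prime_factors_prime_power_times prime_factors_prime_power)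
  have n: "prime_factors ?n = {p, q}" using s[of a b] ab by auto
  have vert: "(\<exists>i>0. d = p ^ i \<and> prime_factors d = {p}) \<or>
      (\<exists>j\<in>{1, 2}. d = q ^ j \<and> prime_factors d = {q})" if "d \<in> hverts ?Y" for d
  proof -
    have d: "d dvd ?n" "prime_factors d \<noteq> {}" "prime_factors d \<noteq> {p, q}"
      using that unfolding support_vertex_iff n by auto
    obtain x y where "d = x * y" "x dvd p ^ a" "y dvd q ^ b" using division_decomp[OF d(1)] by blast
    then obtain i j where ij: "i \<le> a" "j \<le> b" "d = p ^ i * q ^ j"
      using p divides_primepow_nat by metis
    have sd: "prime_factors d = (if i = 0 then {} else {p}) \<union> (if j = 0 then {} else {q})"
      unfolding ij(3) by (rule s)
    show ?thesis
    proof (cases "i = 0")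
      case True
      then have "j \<noteq> 0" using d(2) sd by auto
      then have "j \<in> {1, 2}" using ij(2) ab(3) by auto
      moreover have "d = q ^ j" using True ij(3) by simp
      moreover have "prime_factors d = {q}" using True sd \<open>j \<noteq> 0\<close> by simp
      ultimately show ?thesis by blast
    next
      case False
      then have "j = 0" using d(3) sd by (cases "j = 0") (simp_all add: insert_commute)
      then have "d = p ^ i" using ij(3) by simp
      moreover have "prime_factors d = {p}" using \<open>j = 0\<close> False sd by simp
      ultimately show ?thesis using False by blast
    qed
  qed
  show ?thesis
  proof (rule planar_hypergraph_cover[OF planar_two_primes, where f = ?f])
    show "inj_on ?f (hverts ?H)"
    proof (rule inj_onI, clarify)
      fix i j i' j'
      assume v: "(i, j) \<in> hverts ?H"
        "(i', j') \<in> hverts ?H"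
        and eq: "p ^ i * q ^ j = p ^ i' * q ^ j'"
      have "i = 0 \<longleftrightarrow> i' = 0" "j = 0 \<longleftrightarrow> j' = 0"
        using arg_cong[OF eq, of prime_factors] p(3) unfolding s by (auto split: if_splits)
      moreover have "i = 0 \<or> j = 0" "i' = 0 \<or> j' = 0" using v by auto
      ultimately show "i = i' \<and> j = j'"
        using eq p1 by (auto simp: power_inject_exp)
    qed
    show "d \<in> ?f ` hverts ?H" if "d \<in> hverts ?Y" for d
    proof -
      from vert[OF that] consider i where "i > 0" "d = p ^ i" | j where "j \<in> {1, 2}" "d = q ^ j"
        by blast
      then show ?thesis
      proof cases
        case (1 i)
        then show ?thesis by (intro image_eqI[of _ _ "(i, 0)"]) simp_all
      next
        case (2 j)
        then show ?thesis by (intro image_eqI[of _ _ "(0, j)"]) auto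
      qed
    qed
    show "D \<subseteq> hverts ?Y \<and> D \<in> (`) ?f ` hedges ?H" if D: "D \<in> hedges ?Y" for D
    proof
      show sub: "D \<subseteq> hverts ?Y" using D unfolding support_edge_iff by simp
      have "\<Union>(prime_factors ` D) = {p, q}" using D unfolding support_edge_iff n by simp
      then obtain x y where xy: "x \<in> D" "y \<in> D" "p \<in> prime_factors x" "q \<in> prime_factors y" by blast
      have "prime_factors x \<noteq> {q}" "prime_factors y \<noteq> {p}" using xy p(3) by auto
      moreover have "x \<in> hverts ?Y" "y \<in> hverts ?Y" using sub xy by blast+
      ultimately obtain i j where i: "i > 0" "x = p ^ i" "prime_factors x = {p}"
        and j: "j \<in> {1, 2}" "y = q ^ j" "prime_factors y = {q}"
        using vert by meson
      have "D = {x, y}"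
        by (rule support_edge_eq[OF D]) (use xy i(3) j(3) n in auto)
      then have "D = ?f ` (\<lambda>(i, j). {(i, 0), (0, j)}) (i, j)" using i j by simp
      then show "D \<in> (`) ?f ` hedges ?H"
        using i(1) j(1) by (intro image_eqI[where x = "(\<lambda>(i, j). {(i, 0), (0, j)}) (i, j)"]) auto
    qed
  qed auto
qed

text \<open>The list \<open>?xs\<close> follows the labels of the drawing, which is made for
  exponent 2; for \<open>a = 1\<close> the multiples of \<open>p^2\<close> simply do not occur in
  \<open>?Y\<close>. Hyperedges are sorted by the block that contains \<open>p\<close>.\<close>

lemma planar_three_prime_divisors:
  fixes p q r :: nat
  assumes p: "prime p" "prime q" "prime r" and ne: "p \<noteq> q" "p \<noteq> r" "q \<noteq> r" and a: "a > 0" "a \<le> 2"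
  shows "planar_hypergraph (divisor_hypergraph (p ^ a * (q * r)))"
proof -
  let ?n = "p ^ a * (q * r)"
  let ?Y = "divisor_hypergraph ?n"
  let ?xs = "[q, r, p, p^2, q*r, p*r, p^2*r, p*q, p^2*q]"
  let ?H = "({0,1,2,3,4,5,6,7,8::nat}, {{2,0,1}, {3,0,1}, {2,4}, {3,4}, {0,5}, {0,6}, {1,7}, {1,8}})"
  have pos: "p > 0" "q > 0" "r > 0" using p prime_gt_0_nat by auto
  have s: "prime_factors (p ^ i * (q ^ j * r ^ k)) =
      (if i = 0 then {} else {p}) \<union> ((if j = 0 then {} else {q}) \<union> (if k = 0 then {} else {r}))" for i j k
    using p pos by (simp add: prime_factors_prime_power_times prime_factors_prime_power)
  have n: "prime_factors ?n = {p, q, r}" using s[of a 1 1] a by (simp add: insert_commute)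
  have vert: "prime_factors d = {q} \<and> d = q \<or> prime_factors d = {r} \<and> d = r \<or>
      prime_factors d = {p} \<and> d \<in> {p, p^2} \<or> prime_factors d = {q, r} \<and> d = q * r \<or>
      prime_factors d = {p, r} \<and> d \<in> {p * r, p^2 * r} \<or>
      prime_factors d = {p, q} \<and> d \<in> {p * q, p^2 * q}" if "d \<in> hverts ?Y" for d
  proof -
    have d: "d dvd ?n" "prime_factors d \<noteq> {}" "prime_factors d \<noteq> {p, q, r}"
      using that unfolding support_vertex_iff n by auto
    obtain x y where xy: "d = x * y" "x dvd p ^ a" "y dvd q * r" using division_decomp[OF d(1)] by blast
    obtain y1 y2 where y: "y = y1 * y2" "y1 dvd q ^ 1" "y2 dvd r ^ 1"
      using division_decomp[OF xy(3)] by auto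
    obtain i where i: "i \<le> a" "x = p ^ i" using xy(2) p divides_primepow_nat by metis
    obtain j where j: "j \<le> 1" "y1 = q ^ j" using y(2) p divides_primepow_nat by metis
    obtain k where k: "k \<le> 1" "y2 = r ^ k" using y(3) p divides_primepow_nat by metis
    have de: "d = p ^ i * (q ^ j * r ^ k)" using xy(1) y(1) i(2) j(2) k(2) by simp
    have sd: "prime_factors d = (if i = 0 then {} else {p}) \<union> ((if j = 0 then {} else {q}) \<union> (if k = 0 then {} else {r}))"
      unfolding de by (rule s)
    have "i = 0 \<or> i = 1 \<or> i = 2" "j = 0 \<or> j = 1" "k = 0 \<or> k = 1" using i(1) j(1) k(1) a(2) by auto
    then show ?thesis
      by (elim disjE) (use d(2,3) in \<open>simp_all add: sd insert_commute, simp_all add: de\<close>)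
  qed
  show ?thesis
  proof (rule planar_hypergraph_cover[OF planar_three_primes, where f = "(!) ?xs"])
    \<comment> \<open>The nine labels are told apart by their divisibility by \<open>p\<close>,
      \<open>p^2\<close>, \<open>q\<close> and \<open>r\<close>.\<close>
    have "\<not> p dvd q" "\<not> p dvd r" "\<not> q dvd p" "\<not> q dvd r" "\<not> r dvd p" "\<not> r dvd q"
      using p ne by (auto dest: primes_dvd_imp_eq)
    moreover from this have "\<not> p\<^sup>2 dvd p" "\<not> p\<^sup>2 dvd q" "\<not> p\<^sup>2 dvd r" "\<not> p\<^sup>2 dvd q * r"
        "\<not> p\<^sup>2 dvd p * r" "\<not> p\<^sup>2 dvd p * q"
      using p pos by (auto simp: power2_eq_square prime_dvd_mult_iff dest: dvd_mult_left)
    ultimately have "distinct (map (\<lambda>x. (p dvd x, p\<^sup>2 dvd x, q dvd x, r dvd x)) ?xs)"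
      using p by (simp add: prime_dvd_mult_iff prime_dvd_power_iff)
    then have "distinct ?xs" by (rule distinct_map[THEN iffD1, THEN conjunct1])
    then show "inj_on ((!) ?xs) (hverts ?H)"
      by (rule inj_on_nth) simp
    show "d \<in> (!) ?xs ` hverts ?H" if "d \<in> hverts ?Y" for d
      using vert[OF that] by auto
    show "D \<subseteq> hverts ?Y \<and> D \<in> (`) ((!) ?xs) ` hedges ?H" if D: "D \<in> hedges ?Y" for D
    proof
      show sub: "D \<subseteq> hverts ?Y" using D unfolding support_edge_iff by simp
      have un: "\<Union>(prime_factors ` D) = {p, q, r}"
        and pw: "pairwise (\<lambda>x y. prime_factors x \<inter> prime_factors y = {}) D"
        using D unfolding support_edge_iff n by simp_all
      have "p \<in> \<Union>(prime_factors ` D)" "q \<in> \<Union>(prime_factors ` D)" "r \<in> \<Union>(prime_factors ` D)"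
        unfolding un by simp_all
      then obtain x y z where x: "x \<in> D" "p \<in> prime_factors x"
        and y: "y \<in> D" "q \<in> prime_factors y" and z: "z \<in> D" "r \<in> prime_factors z" by blast
      have vx: "x \<in> hverts ?Y" "y \<in> hverts ?Y" "z \<in> hverts ?Y" using sub x y z by blast+
      have same: "v = w" if "v \<in> D" "w \<in> D" "t \<in> prime_factors v" "t \<in> prime_factors w" for v w t
        using pairwiseD[OF pw that(1,2)] that(3,4) by blast
      have only_q: "prime_factors v = {q} \<and> v = q"
        if "v \<in> hverts ?Y" "q \<in> prime_factors v" "p \<notin> prime_factors v" "r \<notin> prime_factors v" for v
        using vert[OF that(1)] that(2-4) by (elim disjE conjE) simp_all
      have only_qr: "prime_factors v = {q, r} \<and> v = q * r"
        if "v \<in> hverts ?Y" "q \<in> prime_factors v" "r \<in> prime_factors v" "p \<notin> prime_factors v" for v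
        using vert[OF that(1)] that(2-4) ne by (elim disjE conjE) simp_all
      have only_r: "prime_factors v = {r} \<and> v = r"
        if "v \<in> hverts ?Y" "r \<in> prime_factors v" "p \<notin> prime_factors v" "q \<notin> prime_factors v" for v
        using vert[OF that(1)] that(2-4) by (elim disjE conjE) simp_all
      have "D \<in> {{p,q,r}, {p^2,q,r}, {p,q*r}, {p^2,q*r}, {q,p*r}, {q,p^2*r}, {r,p*q}, {r,p^2*q}}"
      proof -
        \<comment> \<open>The block of \<open>p\<close> is \<open>{p}\<close>, \<open>{p, r}\<close>
          or \<open>{p, q}\<close>. In the last two cases the one remaining prime determines the
          hyperedge; in the first, \<open>q\<close> and \<open>r\<close> lie either in separate
          blocks or in one.\<close>
        have "prime_factors x \<noteq> {q}" "prime_factors x \<noteq> {r}" "prime_factors x \<noteq> {q, r}"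
          using x(2) ne by auto
        then consider "prime_factors x = {p}" "x \<in> {p, p^2}"
          | "prime_factors x = {p, r}" "x \<in> {p * r, p^2 * r}"
          | "prime_factors x = {p, q}" "x \<in> {p * q, p^2 * q}"
          using vert[OF vx(1)] by blast
        then show ?thesis
        proof cases
          case 1
          have py: "p \<notin> prime_factors y"
          proof
            assume "p \<in> prime_factors y"
            then have "x = y" by (rule same[OF x(1) y(1) x(2)])
            then show False using 1(1) y(2) ne by simp
          qed
          show ?thesis
          proof (cases "r \<in> prime_factors y")
            case False
            note y' = only_q[OF vx(2) y(2) py False, THEN conjunct1] only_q[OF vx(2) y(2) py False, THEN conjunct2]
            have "p \<notin> prime_factors z"
            proof
              assume "p \<in> prime_factors z"
              then have "x = z" by (rule same[OF x(1) z(1) x(2)])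
              then show False using 1(1) z(2) ne by simp
            qed
            moreover have "q \<notin> prime_factors z"
            proof
              assume "q \<in> prime_factors z"
              then have "y = z" by (rule same[OF y(1) z(1) y(2)])
              then show False using y'(1) z(2) ne by simp
            qed
            ultimately have "prime_factors z = {r} \<and> z = r" by (rule only_r[OF vx(3) z(2)])
            note z' = conjunct1[OF this] conjunct2[OF this]
            have "D = {x, y, z}"
              by (rule support_edge_eq[OF D]) (simp_all add: x y z 1(1) y'(1) z'(1) n insert_commute)
            then have "D = {p,q,r} \<or> D = {p^2,q,r}" using 1(2) y'(2) z'(2) by (elim insertE emptyE) simp_all
            then show ?thesis by (elim disjE) (simp_all only: insert_iff simp_thms)
          next
            case True
            with vx(2) y(2) have "prime_factors y = {q, r} \<and> y = q * r" using py by (rule only_qr)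
            note y' = conjunct1[OF this] conjunct2[OF this]
            have "D = {x, y}"
              by (rule support_edge_eq[OF D]) (simp_all add: x y 1(1) y'(1) n insert_commute)
            then have "D = {p,q*r} \<or> D = {p^2,q*r}" using 1(2) y'(2) by (elim insertE emptyE) simp_all
            then show ?thesis by (elim disjE) (simp_all only: insert_iff simp_thms)
          qed
        next
          case 2
          have "q \<notin> prime_factors x" using 2(1) ne by simp
          then have "x \<noteq> y" using y(2) by blast
          then have "p \<notin> prime_factors y" "r \<notin> prime_factors y"
            using same[OF x(1) y(1)] 2(1) by blast+
          then have "prime_factors y = {q} \<and> y = q" by (rule only_q[OF vx(2) y(2)])
          note y' = conjunct1[OF this] conjunct2[OF this]
          have "D = {y, x}"
            by (rule support_edge_eq[OF D]) (simp_all add: x y 2(1) y'(1) n insert_commute)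
          then have "D = {q,p*r} \<or> D = {q,p^2*r}" using 2(2) y'(2) by (elim insertE emptyE) simp_all
          then show ?thesis by (elim disjE) (simp_all only: insert_iff simp_thms)
        next
          case 3
          have "r \<notin> prime_factors x" using 3(1) ne by simp
          then have "x \<noteq> z" using z(2) by blast
          then have "p \<notin> prime_factors z" "q \<notin> prime_factors z"
            using same[OF x(1) z(1)] 3(1) by blast+
          then have "prime_factors z = {r} \<and> z = r" by (rule only_r[OF vx(3) z(2)])
          note z' = conjunct1[OF this] conjunct2[OF this]
          have "D = {z, x}"
            by (rule support_edge_eq[OF D]) (simp_all add: x z 3(1) z'(1) n insert_commute)
          then have "D = {r,p*q} \<or> D = {r,p^2*q}" using 3(2) z'(2) by (elim insertE emptyE) simp_all
          then show ?thesis by (elim disjE) (simp_all only: insert_iff simp_thms)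
        qed
      qed
      moreover have "(`) ((!) ?xs) ` hedges ?H =
          {{p,q,r}, {p^2,q,r}, {p,q*r}, {p^2,q*r}, {q,p*r}, {q,p^2*r}, {r,p*q}, {r,p^2*q}}"
        by simp
      ultimately show "D \<in> (`) ((!) ?xs) ` hedges ?H" by simp
    qed
  qed auto
qed

section \<open>From the obstructions to the shape of n\<close>

lemma prime_factorization_two:
  fixes n :: nat
  assumes "n > 0" "prime_factors n = {p, q}" "p \<noteq> q"
  obtains a b where "a > 0" "b > 0" "n = p ^ a * q ^ b" "prime p" "prime q"
proof
  have "p \<in> prime_factors n" "q \<in> prime_factors n" using assms(2) by simp_all
  then show "multiplicity p n > 0" "multiplicity q n > 0" "prime p" "prime q"
    by (simp_all add: prime_factors_multiplicity)
  show "n = p ^ multiplicity p n * q ^ multiplicity q n"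
    using prime_factorization_nat[OF assms(1)] assms(3) unfolding assms(2) by simp
qed

lemma prime_factorization_three:
  fixes n :: nat
  assumes "n > 0" "prime_factors n = {p, q, r}" "p \<noteq> q" "p \<noteq> r" "q \<noteq> r"
  obtains a b c where "a > 0" "b > 0" "c > 0" "n = p ^ a * q ^ b * r ^ c" "prime p" "prime q" "prime r"
proof
  have "p \<in> prime_factors n" "q \<in> prime_factors n" "r \<in> prime_factors n" using assms(2) by simp_all
  then show "multiplicity p n > 0" "multiplicity q n > 0" "multiplicity r n > 0"
    "prime p" "prime q" "prime r"
    by (simp_all add: prime_factors_multiplicity)
  show "n = p ^ multiplicity p n * q ^ multiplicity q n * r ^ multiplicity r n"
    using prime_factorization_nat[OF assms(1)] assms(3-5) unfolding assms(2) by simp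
qed

text \<open>Two primes: the exponents do not both reach 3, and a prime whose exponent is at most 2
  is listed second. Three primes: no exponent reaches 3 and at most one equals 2; its prime is
  listed first.\<close>

lemma planar_divisor_hypergraph_cases:
  fixes n :: nat
  assumes "n > 0" "card (prime_factors n) \<ge> 2" "planar_hypergraph (divisor_hypergraph n)"
  obtains p q a where "prime p" "prime q" "p \<noteq> q" "a > 0" "n = p ^ a * q \<or> n = p ^ a * q\<^sup>2"
  | p q r where "prime p" "prime q" "prime r" "p \<noteq> q" "p \<noteq> r" "q \<noteq> r" "n = p * q * r \<or> n = p\<^sup>2 * q * r"
proof -
  have "card (prime_factors n) < 4" using not_planar_four_primes_divisors[OF assms(1)] assms(3) by (meson not_le)
  with assms(2) have "card (prime_factors n) = 2 \<or> card (prime_factors n) = 3" by linarith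
  then consider "card (prime_factors n) = 2" | "card (prime_factors n) = 3" by blast
  then show thesis
  proof cases
    case 1
    then obtain p q where pq: "prime_factors n = {p, q}" "p \<noteq> q" by (metis card_2_iff)
    from prime_factorization_two[OF assms(1) this] obtain a b
      where ab: "a > 0" "b > 0" "n = p ^ a * q ^ b" "prime p" "prime q" .
    have "\<not> (p ^ 3 dvd n \<and> q ^ 3 dvd n)" using not_planar_cubes_divisors[OF assms(1) pq] assms(3) by blast
    moreover have "p ^ 3 dvd n" if "a \<ge> 3" unfolding ab(3) using that by (simp add: le_imp_power_dvd)
    moreover have "q ^ 3 dvd n" if "b \<ge> 3" unfolding ab(3) using that by (simp add: le_imp_power_dvd)
    ultimately have "a \<le> 2 \<or> b \<le> 2" by linarith
    then have "b = 1 \<or> b = 2 \<or> a = 1 \<or> a = 2" using ab(1,2) by linarith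
    then show thesis
      using that(1)[of p q a] that(1)[of q p b] ab pq(2) by (auto simp: mult.commute)
  next
    case 2
    then obtain p q r where pqr: "prime_factors n = {p, q, r}" "p \<noteq> q" "p \<noteq> r" "q \<noteq> r"
      by (metis card_3_iff)
    from prime_factorization_three[OF assms(1) this] obtain a b c
      where abc: "a > 0" "b > 0" "c > 0" "n = p ^ a * q ^ b * r ^ c" "prime p" "prime q" "prime r" .
    have dv: "p ^ k dvd n" if "k \<le> a" for k unfolding abc(4) using that by (simp add: le_imp_power_dvd)
    have dq: "q ^ k dvd n" if "k \<le> b" for k unfolding abc(4) using that by (simp add: le_imp_power_dvd)
    have dr: "r ^ k dvd n" if "k \<le> c" for k unfolding abc(4) using that by (simp add: le_imp_power_dvd)
    have three: "card (prime_factors n) \<ge> 3" using 2 by simp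
    have cube: "\<not> x ^ 3 dvd n" if "prime x" for x
      using not_planar_cube_divisors[OF assms(1) three that] assms(3) by blast
    have sq: "\<not> (x\<^sup>2 dvd n \<and> y\<^sup>2 dvd n)" if "prime x" "prime y" "x \<noteq> y" for x y
      using not_planar_two_squares_divisors[OF assms(1) three that] assms(3) by blast
    have "a \<le> 2" "b \<le> 2" "c \<le> 2"
      using cube[OF abc(5)] cube[OF abc(6)] cube[OF abc(7)] dv[of 3] dq[of 3] dr[of 3] by linarith+
    moreover have "\<not> (a \<ge> 2 \<and> b \<ge> 2)" "\<not> (a \<ge> 2 \<and> c \<ge> 2)" "\<not> (b \<ge> 2 \<and> c \<ge> 2)"
      using sq[OF abc(5,6)] sq[OF abc(5,7)] sq[OF abc(6,7)] pqr dv[of 2] dq[of 2] dr[of 2] by blast+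
    ultimately have "a = 1 \<and> b = 1 \<and> c = 1 \<or> a = 2 \<and> b = 1 \<and> c = 1 \<or>
      a = 1 \<and> b = 2 \<and> c = 1 \<or> a = 1 \<and> b = 1 \<and> c = 2" using abc(1-3) by linarith
    then consider "a = 1" "b = 1" "c = 1" | "a = 2" "b = 1" "c = 1" | "a = 1" "b = 2" "c = 1"
      | "a = 1" "b = 1" "c = 2" by blast
    then show thesis
    proof cases
      case 1
      show thesis by (rule that(2)[of p q r]) (use abc pqr(2-4) 1 in simp_all)
    next
      case 2
      show thesis by (rule that(2)[of p q r]) (use abc pqr(2-4) 2 in simp_all)
    next
      case 3
      show thesis by (rule that(2)[of q p r]) (use abc pqr(2-4) 3 in simp_all)
    next
      case 4
      show thesis by (rule that(2)[of r p q]) (use abc pqr(2-4) 4 in \<open>simp_all add: mult.commute\<close>)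
    qed
  qed
qed

theorem theorem4p3:
  fixes n :: nat
  assumes "n > 0" and "card (prime_factors n) \<ge> 2"
  shows "planar_hypergraph (intersection_hypergraph (integer_mod_group n)) \<longleftrightarrow>
    (\<exists>p1 p2 p3 \<alpha>1 :: nat.
       prime p1 \<and> prime p2 \<and> prime p3 \<and> p1 \<noteq> p2 \<and> p1 \<noteq> p3 \<and> p2 \<noteq> p3 \<and> \<alpha>1 > 0 \<and>
       (n = p1 ^ \<alpha>1 * p2 \<or> n = p1 ^ \<alpha>1 * p2\<^sup>2 \<or> n = p1 * p2 * p3 \<or> n = p1\<^sup>2 * p2 * p3))"
  unfolding planar_intersection_hypergraph_integer_mod_group[OF assms]
proof
  assume "planar_hypergraph (divisor_hypergraph n)"
  with assms show "\<exists>p1 p2 p3 \<alpha>1 :: nat.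
       prime p1 \<and> prime p2 \<and> prime p3 \<and> p1 \<noteq> p2 \<and> p1 \<noteq> p3 \<and> p2 \<noteq> p3 \<and> \<alpha>1 > 0 \<and>
       (n = p1 ^ \<alpha>1 * p2 \<or> n = p1 ^ \<alpha>1 * p2\<^sup>2 \<or> n = p1 * p2 * p3 \<or> n = p1\<^sup>2 * p2 * p3)"
  proof (cases rule: planar_divisor_hypergraph_cases)
    case (1 p q a)
    \<comment> \<open>The formula speaks of three distinct primes even if \<open>n\<close> has only
      two, so a third one is taken beyond both.\<close>
    obtain r where "prime r" "r > p + q" using bigger_prime by blast
    then have "prime r" "p \<noteq> r" "q \<noteq> r" by auto
    with 1 show ?thesis by blast
  next
    case (2 p q r)
    then show ?thesis by (intro exI[of _ p] exI[of _ q] exI[of _ r] exI[of _ 1]) auto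
  qed
next
  assume "\<exists>p1 p2 p3 \<alpha>1 :: nat.
       prime p1 \<and> prime p2 \<and> prime p3 \<and> p1 \<noteq> p2 \<and> p1 \<noteq> p3 \<and> p2 \<noteq> p3 \<and> \<alpha>1 > 0 \<and>
       (n = p1 ^ \<alpha>1 * p2 \<or> n = p1 ^ \<alpha>1 * p2\<^sup>2 \<or> n = p1 * p2 * p3 \<or> n = p1\<^sup>2 * p2 * p3)"
  then obtain p q r a :: nat where p: "prime p" "prime q" "prime r" "p \<noteq> q" "p \<noteq> r" "q \<noteq> r" "a > 0"
    and "n = p ^ a * q \<or> n = p ^ a * q\<^sup>2 \<or> n = p * q * r \<or> n = p\<^sup>2 * q * r" by blast
  then consider "n = p ^ a * q ^ 1" | "n = p ^ a * q ^ 2" | "n = p ^ 1 * (q * r)" | "n = p ^ 2 * (q * r)"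
    by (auto simp: mult.assoc)
  then show "planar_hypergraph (divisor_hypergraph n)"
  proof cases
    case 1
    show ?thesis unfolding 1 by (rule planar_two_prime_divisors) (use p in auto)
  next
    case 2
    show ?thesis unfolding 2 by (rule planar_two_prime_divisors) (use p in auto)
  next
    case 3
    show ?thesis unfolding 3 by (rule planar_three_prime_divisors) (use p in auto)
  next
    case 4
    show ?thesis unfolding 4 by (rule planar_three_prime_divisors) (use p in auto)
  qed
qed

end
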